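(* For all $(t,q)\in D$, $$-t\log4+\log\zeta(2t-q)\le P(t,q)\le\log\zeta(2t-q).$$ Consequently: (1) $P(0,q)=\log\zeta(-q)$, and for any point $(t_0,q_0)$ on the line $2t-q=1$, $\lim_{(t,q)\to(t_0,q_0)}P(t,q)=\infty$; (2) for fixed $t\in\mathbb{R}$, $\lim_{q\to 2t-1}\frac{\partial P}{\partial q}(t,q)=+\infty$; (3) for fixed $t\in\mathbb{R}$, $\lim_{q\to-\infty}\frac{P(t,q)}q=0$ and $\lim_{q\to-\infty}\frac{\partial P}{\partial q}(t,q)=0$.
   Context: $D=\{(t,q)\in\mathbb{R}^2:2t-q>1\}$; $\zeta(s)=\sum_{n\ge1}n^{-s}$ for $s>1$. Write $[\omega_1,\dots,\omega_n+x]=\cfrac{1}{\omega_1+\cfrac{1}{\ddots+\cfrac{1}{\omega_n+x}}}$. For $(t,q)\in D$, $$P(t,q)=\lim_{n\to\infty}\frac1n\log\sum_{\omega_1=1}^\infty\cdots\sum_{\omega_n=1}^\infty\exp\Big(\sup_{x\in[0,1]}\log\prod_{j=1}^n\omega_j^q\,([\omega_j,\dots,\omega_n+x])^{2t}\Big),$$ a real-analytic function on $D$. Since $P$ is defined only on $D$, all values and limits are understood with $(t,q)\in D$ (so $q<-1$ in the formula for $P(0,q)$, and $q\to2t-1$ from below in (2)).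
   Formalization: For t<0 the displayed bound is contradictory (−t log 4 > 0 makes the lower bound exceed the upper); it is stated as printed for t≥0, and for t≤0 with the bounds exchanged: log ζ(2t−q) ≤ P(t,q) ≤ −t log 4 + log ζ(2t−q). *)

theory Defs
  imports "HOL-Analysis.Analysis"
begin

definition pressure_dom :: "(real \<times> real) set" where
  "pressure_dom = {(t, q). 2 * t - q > 1}"

text \<open>The Riemann zeta function as a real Dirichlet series; only used for arguments \<open>s > 1\<close>.\<close>

definition zeta :: "real \<Rightarrow> real" where
  "zeta s = (\<Sum>n. real (Suc n) powr (- s))"

text \<open>\<open>cfrac [w\<^sub>1, \<dots>, w\<^sub>n] x\<close> is the finite continued fraction \<open>[w\<^sub>1, \<dots>, w\<^sub>n + x]\<close>: the
  innermost fraction is \<open>1 / (w\<^sub>n + x)\<close>.\<close>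

fun cfrac :: "nat list \<Rightarrow> real \<Rightarrow> real" where
  "cfrac [] x = x"
| "cfrac (w # ws) x = 1 / (real w + cfrac ws x)"

definition words :: "nat \<Rightarrow> nat list set" where
  "words n = {ws. length ws = n \<and> (\<forall>w\<in>set ws. w \<ge> 1)}"

text \<open>The \<open>n\<close>-fold sum over \<open>w\<^sub>1, \<dots>, w\<^sub>n \<ge> 1\<close> is one unordered sum over the words of length \<open>n\<close>.
  All terms are positive, so this agrees with the iterated sum, which converges on
  \<^const>\<open>pressure_dom\<close>. List positions start at \<open>0\<close>, so \<open>drop j ws\<close> begins with \<open>ws ! j\<close>.\<close>

definition partition_sum :: "real \<Rightarrow> real \<Rightarrow> nat \<Rightarrow> real" where
  "partition_sum t q n =
     (\<Sum>\<^sub>\<infinity>ws\<in>words n.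
        exp (SUP x\<in>{0..1}. ln (\<Prod>j<n. real (ws ! j) powr q * cfrac (drop j ws) x powr (2 * t))))"

definition pressure :: "real \<Rightarrow> real \<Rightarrow> real" where
  "pressure t q = lim (\<lambda>n. 1 / real n * ln (partition_sum t q n))"

end

theory Submission
  imports Defs
begin

text \<open>The partition function is, up to bounded distortion, the \<open>n\<close>-th iterate of the transfer operator
  \<open>L f x = (\<Sum>w\<ge>1. w\<^sup>q (w + x)\<^sup>-\<^sup>2\<^sup>t f (1 / (w + x)))\<close> applied to the constant \<open>1\<close>. In the metric
  \<open>\<bar>ln (1 + x) - ln (1 + y)\<bar>\<close> every inverse branch contracts by \<open>1/2\<close>, so Markov operators
  \<open>f \<mapsto> L (v f) / L v\<close> with log-Lipschitz \<open>v\<close> contract a suitable modulus of continuity. Applied to the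
  ratios \<open>L\<^sup>n\<^sup>+\<^sup>1 1 / L\<^sup>n 1\<close> this gives a positive eigenfunction \<open>h\<close> with eigenvalue \<open>exp P\<close>; hence sub- and
  supersolutions of \<open>L F = \<mu> F\<close> bound \<open>P\<close>, and \<open>F = 1\<close> gives the zeta bounds. For the derivative,
  perturbing \<open>h\<close> to first order gives sub- and supersolutions at \<open>q + s\<close>, so that \<open>P\<close> is differentiable in
  \<open>q\<close> with \<open>P(q) + s P'(q) \<le> P(q + s)\<close>, and the limits of \<open>P'\<close> follow from this convexity inequality.\<close>

section \<open>The transfer operator of the Gauss map\<close>

definition ldist :: "real \<Rightarrow> real \<Rightarrow> real" where
  "ldist x y = \<bar>ln (1 + x) - ln (1 + y)\<bar>"

definition branch :: "nat \<Rightarrow> real \<Rightarrow> real" where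
  "branch n x = 1 / (real (Suc n) + x)"

definition transfer :: "real \<Rightarrow> (nat \<Rightarrow> real) \<Rightarrow> (real \<Rightarrow> real) \<Rightarrow> real \<Rightarrow> real" where
  "transfer t c f x = (\<Sum>\<^sub>\<infinity>n. c n * branch n x powr (2 * t) * f (branch n x))"

definition admissible :: "real \<Rightarrow> (nat \<Rightarrow> real) \<Rightarrow> bool" where
  "admissible t c \<longleftrightarrow> (\<forall>n. 0 \<le> c n) \<and> (\<lambda>n. c n * real (Suc n) powr (- 2 * t)) summable_on UNIV"

definition loglip :: "real \<Rightarrow> (real \<Rightarrow> real) \<Rightarrow> bool" where
  "loglip K f \<longleftrightarrow> (\<forall>x\<in>{0..1}. 0 < f x) \<and>
     (\<forall>x\<in>{0..1}. \<forall>y\<in>{0..1}. f x \<le> exp (K * ldist x y) * f y)"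

lemma ldist_nonneg: "0 \<le> ldist x y"
  by (simp add: ldist_def)

lemma ldist_commute: "ldist x y = ldist y x"
  by (simp add: ldist_def abs_minus_commute)

lemma ldist_le:
  assumes "x \<in> {0..1}" "y \<in> {0..1}"
  shows "ldist x y \<le> ln 2"
proof -
  have "0 \<le> ln (1 + x)" "0 \<le> ln (1 + y)" "ln (1 + x) \<le> ln 2" "ln (1 + y) \<le> ln 2"
    using assms by auto
  then show ?thesis by (simp add: ldist_def)
qed

lemma branch_pos: "x \<in> {0..1} \<Longrightarrow> 0 < branch n x"
  by (simp add: branch_def)

lemma branch_mem: "x \<in> {0..1} \<Longrightarrow> branch n x \<in> {0..1}"
  by (simp add: branch_def)

lemma ldist_branch:
  assumes "x \<in> {0..1}" "y \<in> {0..1}"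
  shows "ldist (branch n x) (branch n y) \<le> ldist x y / 2"
proof -
  have eq: "ln (1 + branch n x) = ln (real n + 2 + x) - ln (real n + 1 + x)" if "0 \<le> x" for x
  proof -
    have "1 + branch n x = (real n + 2 + x) / (real n + 1 + x)"
      using that by (simp add: branch_def field_simps)
    then show ?thesis using that by (simp add: ln_div)
  qed
  have main: "ldist (branch n x) (branch n y) \<le> ldist x y / 2" if "0 \<le> x" "x \<le> y" for x y
  proof -
    define g where "g = (\<lambda>x. ln (real n + 2 + x) - ln (real n + 1 + x) + ln (1 + x) / 2)"
    have "g x \<le> g y"
    proof (rule DERIV_nonneg_imp_nondecreasing[OF that(2)])
      fix z assume z: "x \<le> z" "z \<le> y"
      have z0: "0 \<le> z" using that z by simp
      have "(1 + z) * 2 \<le> (real n + 1 + z) * (real n + 2 + z)"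
        by (rule mult_mono) (use z0 in auto)
      then have "1 / ((real n + 1 + z) * (real n + 2 + z)) \<le> 1 / (1 + z) / 2"
        using z0 unfolding divide_divide_eq_left by (intro divide_left_mono) auto
      moreover have "1 / (real n + 2 + z) - 1 / (real n + 1 + z) = - (1 / ((real n + 1 + z) * (real n + 2 + z)))"
        using z0 by (simp add: divide_simps)
      ultimately have "0 \<le> 1 / (real n + 2 + z) - 1 / (real n + 1 + z) + 1 / (1 + z) / 2"
        by linarith
      moreover have "(g has_real_derivative
          1 / (real n + 2 + z) * 1 - 1 / (real n + 1 + z) * 1 + 1 / (1 + z) * 1 / 2) (at z)"
        unfolding g_def using z0
        by (intro DERIV_add DERIV_diff DERIV_cdivide DERIV_ln_divide[THEN DERIV_chain2]) (auto intro!: derivative_eq_intros)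
      ultimately show "\<exists>d. (g has_real_derivative d) (at z) \<and> 0 \<le> d"
        unfolding mult_1_right by blast
    qed
    moreover have "(real n + 2 + y) / (real n + 1 + y) \<le> (real n + 2 + x) / (real n + 1 + x)"
      using that by (simp add: field_simps)
    then have "ln ((real n + 2 + y) / (real n + 1 + y)) \<le> ln ((real n + 2 + x) / (real n + 1 + x))"
      using that by simp
    then have "ln (real n + 2 + y) - ln (real n + 1 + y) \<le> ln (real n + 2 + x) - ln (real n + 1 + x)"
      using that by (simp add: ln_div)
    moreover have "ln (1 + x) \<le> ln (1 + y)" using that by simp
    ultimately show ?thesis
      using that by (simp add: ldist_def eq g_def)
  qed
  show ?thesis
    using main[of x y] main[of y x] assms by (cases "x \<le> y") (auto simp: ldist_commute)
qed

lemma abs_ln_branch_diff_le: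
  assumes "x \<in> {0..1}" "y \<in> {0..1}"
  shows "\<bar>ln (branch n x) - ln (branch n y)\<bar> \<le> ldist x y"
proof -
  have main: "\<bar>ln (real n + 1 + x) - ln (real n + 1 + y)\<bar> \<le> ldist x y" if "0 \<le> x" "x \<le> y" for x y
  proof -
    have "(real n + 1 + y) / (real n + 1 + x) \<le> (1 + y) / (1 + x)"
      using that mult_right_mono[OF that(2), of "real n"] by (simp add: field_simps)
    then have "ln ((real n + 1 + y) / (real n + 1 + x)) \<le> ln ((1 + y) / (1 + x))"
      using that by simp
    moreover have "ln (real n + 1 + x) \<le> ln (real n + 1 + y)" "ln (1 + x) \<le> ln (1 + y)"
      using that by auto
    ultimately show ?thesis
      using that by (simp add: ln_div ldist_def)
  qed
  have "ln (branch n x) = - ln (real n + 1 + x)" if "0 \<le> x" for x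
    using that by (simp add: branch_def ln_div add.commute)
  then show ?thesis
    using main[of x y] main[of y x] assms by (cases "x \<le> y") (auto simp: ldist_commute)
qed

lemma branch_powr_le:
  assumes "x \<in> {0..1}" "y \<in> {0..1}"
  shows "branch n x powr (2 * t) \<le> exp (2 * \<bar>t\<bar> * ldist x y) * branch n y powr (2 * t)"
proof -
  have "2 * t * (ln (branch n x) - ln (branch n y)) \<le> \<bar>2 * t * (ln (branch n x) - ln (branch n y))\<bar>"
    by simp
  also have "\<dots> \<le> 2 * \<bar>t\<bar> * ldist x y"
    using abs_ln_branch_diff_le[OF assms, of n] by (simp add: abs_mult mult_left_mono)
  finally have "2 * t * ln (branch n x) \<le> 2 * \<bar>t\<bar> * ldist x y + 2 * t * ln (branch n y)"
    by (simp add: algebra_simps)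
  then show ?thesis
    using branch_pos[OF assms(1), of n] branch_pos[OF assms(2), of n]
    by (simp add: powr_def flip: exp_add)
qed

lemma branch_powr_bounds:
  assumes "x \<in> {0..1}"
  shows "branch n x powr (2 * t) \<le> 4 powr max 0 (- t) * real (Suc n) powr (- 2 * t)"
    and "4 powr min 0 (- t) * real (Suc n) powr (- 2 * t) \<le> branch n x powr (2 * t)"
proof -
  define b where "b = real (Suc n) * branch n x"
  have b: "1 / 2 \<le> b" "b \<le> 1"
    using assms by (auto simp: b_def branch_def field_simps)
  have eq: "branch n x powr (2 * t) = b powr (2 * t) * real (Suc n) powr (- 2 * t)"
  proof -
    have "branch n x = b * inverse (real (Suc n))" by (simp add: b_def)
    then show ?thesis
      using b by (simp add: powr_mult inverse_powr powr_minus del: of_nat_Suc)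
  qed
  have four: "(1 / 2 :: real) powr (2 * t) = 4 powr (- t)" for t
  proof -
    have "(1 / 2 :: real) powr (2 * t) = ((1 / 2) powr 2) powr t" by (simp only: powr_powr)
    also have "\<dots> = 4 powr (- t)" by (simp add: powr_minus power_one_over powr_divide field_simps)
    finally show ?thesis .
  qed
  have "b powr (2 * t) \<le> 4 powr max 0 (- t)"
  proof (cases "t \<ge> 0")
    case True
    then have "b powr (2 * t) \<le> 1 powr (2 * t)" using b by (intro powr_mono2) auto
    with True show ?thesis by simp
  next
    case False
    then have "b powr (2 * t) \<le> (1 / 2) powr (2 * t)" using b by (intro powr_mono2') auto
    with False show ?thesis by (simp add: four)
  qed
  then show "branch n x powr (2 * t) \<le> 4 powr max 0 (- t) * real (Suc n) powr (- 2 * t)"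
    unfolding eq by (intro mult_right_mono) auto
  have "4 powr min 0 (- t) \<le> b powr (2 * t)"
  proof (cases "t \<ge> 0")
    case True
    then have "(1 / 2) powr (2 * t) \<le> b powr (2 * t)" using b by (intro powr_mono2) auto
    with True show ?thesis by (simp add: four)
  next
    case False
    then have "1 powr (2 * t) \<le> b powr (2 * t)" using b by (intro powr_mono2') auto
    with False show ?thesis by simp
  qed
  then show "4 powr min 0 (- t) * real (Suc n) powr (- 2 * t) \<le> branch n x powr (2 * t)"
    unfolding eq by (intro mult_right_mono) auto
qed

lemma transfer_summable:
  assumes c: "admissible t c" and f: "bounded (f ` {0..1})" and x: "x \<in> {0..1}"
  shows "(\<lambda>n. c n * branch n x powr (2 * t) * f (branch n x)) summable_on UNIV"
proof -
  obtain B where B: "\<And>y. y \<in> {0..1} \<Longrightarrow> \<bar>f y\<bar> \<le> B"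
    using f unfolding bounded_iff by (metis imageI real_norm_def)
  have B0: "0 \<le> B" using B[OF x] by simp
  have c0: "0 \<le> c n" for n using c by (simp add: admissible_def)
  have "(\<lambda>n. (4 powr max 0 (- t) * B) * (c n * real (Suc n) powr (- 2 * t))) summable_on UNIV"
    using c by (intro summable_on_cmult_right) (simp add: admissible_def)
  moreover have "norm (c n * branch n x powr (2 * t) * f (branch n x)) \<le>
      (4 powr max 0 (- t) * B) * (c n * real (Suc n) powr (- 2 * t))" for n
  proof -
    have "(c n * branch n x powr (2 * t)) * \<bar>f (branch n x)\<bar> \<le>
      (c n * (4 powr max 0 (- t) * real (Suc n) powr (- 2 * t))) * B"
      using branch_powr_bounds(1)[OF x, of n t] c0[of n] B[OF branch_mem[OF x]]
      by (intro mult_mono mult_left_mono) auto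
    then show ?thesis using c0[of n] by (simp add: abs_mult algebra_simps)
  qed
  ultimately show ?thesis
    by (rule abs_summable_summable[OF Infinite_Sum.abs_summable_on_comparison_test'])
qed

lemma transfer_has_sum:
  assumes "admissible t c" "bounded (f ` {0..1})" "x \<in> {0..1}"
  shows "((\<lambda>n. c n * branch n x powr (2 * t) * f (branch n x)) has_sum transfer t c f x) UNIV"
  unfolding transfer_def using transfer_summable[OF assms] by (rule has_sum_infsum)

lemma transfer_mono:
  assumes "admissible t c" "bounded (f ` {0..1})" "bounded (g ` {0..1})" "x \<in> {0..1}"
    and "\<And>y. y \<in> {0..1} \<Longrightarrow> f y \<le> g y"
  shows "transfer t c f x \<le> transfer t c g x"
  using transfer_has_sum[OF assms(1,2,4)] transfer_has_sum[OF assms(1,3,4)]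
  by (rule has_sum_mono)
    (use assms(1,5) branch_mem[OF assms(4)] in \<open>auto simp: admissible_def intro!: mult_left_mono\<close>)

lemma transfer_cmult:
  "transfer t c (\<lambda>y. k * f y) x = k * transfer t c f x"
proof -
  have "transfer t c (\<lambda>y. k * f y) x
      = (\<Sum>\<^sub>\<infinity>n. k * (c n * branch n x powr (2 * t) * f (branch n x)))"
    by (simp add: transfer_def mult_ac)
  then show ?thesis by (simp add: transfer_def infsum_cmult_right')
qed

lemma transfer_cong:
  assumes "x \<in> {0..1}" "\<And>y. y \<in> {0..1} \<Longrightarrow> f y = g y"
  shows "transfer t c f x = transfer t c g x"
  unfolding transfer_def using assms branch_mem by (intro infsum_cong) auto

section \<open>Contraction of Markov operators and the eigenfunction\<close>

definition markov :: "real \<Rightarrow> (nat \<Rightarrow> real) \<Rightarrow> (real \<Rightarrow> real) \<Rightarrow> (real \<Rightarrow> real) \<Rightarrow> real \<Rightarrow> real" where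
  "markov t c v f x = transfer t c (\<lambda>y. v y * f y) x / transfer t c v x"

definition distort :: "real \<Rightarrow> real" where
  "distort t = 8 * \<bar>t\<bar> + 1"

definition rate :: "real \<Rightarrow> real" where
  "rate t = 1 - exp (- distort t * ln 2) ^ 3 / 4"

text \<open>The bound is concave in the distance: unlike a Lipschitz bound, it improves by a fixed factor
  under one application of a Markov operator, see \<open>markov_contr\<close>.\<close>

definition contr :: "real \<Rightarrow> real \<Rightarrow> (real \<Rightarrow> real) \<Rightarrow> bool" where
  "contr t A f \<longleftrightarrow> (\<forall>x\<in>{0..1}. \<forall>y\<in>{0..1}. f x - f y \<le> A * (1 - exp (- 4 * distort t * ldist x y)))"

lemma distort_pos: "0 < distort t"
  by (simp add: distort_def add_nonneg_pos)

lemma rate_bounds: "0 < rate t" "rate t < 1"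
proof -
  have "exp (- distort t * ln 2) ^ 3 \<le> 1"
    using distort_pos[of t] by (intro power_le_one) auto
  then show "0 < rate t" by (simp add: rate_def)
  show "rate t < 1" by (simp add: rate_def)
qed

lemma loglip_bounds:
  assumes "loglip K f"
  obtains m M where "0 < m" "\<And>x. x \<in> {0..1} \<Longrightarrow> m \<le> f x" "\<And>x. x \<in> {0..1} \<Longrightarrow> f x \<le> M"
proof
  have f0: "0 < f 0" using assms by (simp add: loglip_def)
  show "0 < exp (- \<bar>K\<bar> * ln 2) * f 0" using f0 by simp
  fix x :: real assume x: "x \<in> {0..1}"
  have le: "K * ldist y z \<le> \<bar>K\<bar> * ln 2" if "y \<in> {0..1}" "z \<in> {0..1}" for y z
    using ldist_le[OF that] ldist_nonneg[of y z] by (intro mult_mono) auto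
  have "f 0 \<le> exp (K * ldist 0 x) * f x" using assms x by (simp add: loglip_def)
  also have "\<dots> \<le> exp (\<bar>K\<bar> * ln 2) * f x"
    using le[of 0 x] x assms by (intro mult_right_mono) (auto simp: loglip_def intro: less_imp_le)
  finally show "exp (- \<bar>K\<bar> * ln 2) * f 0 \<le> f x" by (simp add: exp_minus field_simps)
  have "f x \<le> exp (K * ldist x 0) * f 0" using assms x by (simp add: loglip_def)
  also have "\<dots> \<le> exp (\<bar>K\<bar> * ln 2) * f 0"
    using le[of x 0] x f0 by (intro mult_right_mono) auto
  finally show "f x \<le> exp (\<bar>K\<bar> * ln 2) * f 0" .
qed

lemma bounded_imageI:
  fixes f :: "real \<Rightarrow> real"
  assumes "\<And>x. x \<in> A \<Longrightarrow> \<bar>f x\<bar> \<le> B"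
  shows "bounded (f ` A)"
  unfolding bounded_iff using assms by auto

lemma bounded_imageD:
  fixes f :: "real \<Rightarrow> real"
  assumes "bounded (f ` A)"
  obtains B where "0 \<le> B" "\<And>x. x \<in> A \<Longrightarrow> \<bar>f x\<bar> \<le> B"
proof -
  obtain B where B: "\<And>x. x \<in> A \<Longrightarrow> \<bar>f x\<bar> \<le> B"
    using assms unfolding bounded_iff by (metis imageI real_norm_def)
  show ?thesis by (rule that[of "max B 0"]) (use B in \<open>auto simp: le_max_iff_disj\<close>)
qed

lemma bounded_image_mult:
  fixes f g :: "real \<Rightarrow> real"
  assumes "bounded (f ` A)" "bounded (g ` A)"
  shows "bounded ((\<lambda>x. f x * g x) ` A)"
proof -
  obtain B C where B: "\<And>x. x \<in> A \<Longrightarrow> \<bar>f x\<bar> \<le> B" "\<And>x. x \<in> A \<Longrightarrow> \<bar>g x\<bar> \<le> C"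
    and BC: "0 \<le> B" "0 \<le> C"
    using assms by (metis bounded_imageD)
  show ?thesis
    by (rule bounded_imageI[where B = "B * C"]) (use B BC in \<open>auto simp: abs_mult intro!: mult_mono\<close>)
qed

lemma bounded_image_cmult:
  fixes f :: "real \<Rightarrow> real"
  assumes "bounded (f ` A)"
  shows "bounded ((\<lambda>x. k * f x) ` A)"
  using bounded_image_mult[of "\<lambda>_. k", OF _ assms]
  by (metis (no_types, lifting) bounded_imageI order_refl)

lemma loglip_bounded:
  assumes "loglip K f" shows "bounded (f ` {0..1})"
proof -
  obtain m M where "0 < m" "\<And>x. x \<in> {0..1} \<Longrightarrow> m \<le> f x" "\<And>x. x \<in> {0..1} \<Longrightarrow> f x \<le> M"
    using loglip_bounds[OF assms] by blast
  then show ?thesis by (intro bounded_imageI[where B = M]) (smt (verit))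
qed

lemma transfer_distortion:
  assumes c: "admissible t c" and f: "loglip K f" and xy: "x \<in> {0..1}" "y \<in> {0..1}" and K: "0 \<le> K"
  shows "transfer t c f x \<le> exp ((2 * \<bar>t\<bar> + K / 2) * ldist x y) * transfer t c f y"
proof (rule has_sum_mono[OF transfer_has_sum[OF c loglip_bounded[OF f] xy(1)]
      has_sum_cmult_right[OF transfer_has_sum[OF c loglip_bounded[OF f] xy(2)]]])
  fix n
  have cn: "0 \<le> c n" using c by (simp add: admissible_def)
  have pos: "0 < f (branch n x)" "0 < f (branch n y)"
    using f branch_mem xy by (auto simp: loglip_def)
  have "f (branch n x) \<le> exp (K * ldist (branch n x) (branch n y)) * f (branch n y)"
    using f branch_mem xy by (auto simp: loglip_def)
  also have "\<dots> \<le> exp (K * (ldist x y / 2)) * f (branch n y)"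
    using mult_left_mono[OF ldist_branch[OF xy] K] pos by (intro mult_right_mono) auto
  finally have 1: "f (branch n x) \<le> exp (K * (ldist x y / 2)) * f (branch n y)" .
  have "branch n x powr (2 * t) * f (branch n x) \<le>
     (exp (2 * \<bar>t\<bar> * ldist x y) * branch n y powr (2 * t)) * (exp (K * (ldist x y / 2)) * f (branch n y))"
    by (intro mult_mono branch_powr_le xy 1) (use pos in auto)
  also have "\<dots> = (exp (2 * \<bar>t\<bar> * ldist x y) * exp (K * (ldist x y / 2))) * (branch n y powr (2 * t) * f (branch n y))"
    by (simp only: mult_ac)
  also have "\<dots> = exp ((2 * \<bar>t\<bar> + K / 2) * ldist x y) * (branch n y powr (2 * t) * f (branch n y))"
    by (simp add: distrib_right flip: exp_add)
  finally show "c n * branch n x powr (2 * t) * f (branch n x) \<le>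
      exp ((2 * \<bar>t\<bar> + K / 2) * ldist x y) * (c n * branch n y powr (2 * t) * f (branch n y))"
    using mult_left_mono[OF _ cn] by (fastforce simp: mult_ac)
qed

lemma transfer_pos:
  assumes c: "admissible t c" "c 0 > 0" and f: "loglip K f" and x: "x \<in> {0..1}"
  shows "0 < transfer t c f x"
proof -
  have pos: "0 < f (branch n x)" for n
    using f branch_mem[OF x] by (auto simp: loglip_def)
  have "0 < c 0 * branch 0 x powr (2 * t) * f (branch 0 x)"
    using c pos branch_pos[OF x, of 0] by (intro mult_pos_pos) auto
  also have "\<dots> = (\<Sum>n\<in>{0}. c n * branch n x powr (2 * t) * f (branch n x))" by simp
  also have "\<dots> \<le> transfer t c f x"
    unfolding transfer_def
    by (rule finite_sum_le_infsum[OF transfer_summable[OF c(1) loglip_bounded[OF f] x]])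
      (use c pos in \<open>auto simp: admissible_def intro!: mult_nonneg_nonneg intro: less_imp_le\<close>)
  finally show ?thesis .
qed

lemma transfer_loglip:
  assumes "admissible t c" "c 0 > 0" "loglip (4 * \<bar>t\<bar>) f"
  shows "loglip (4 * \<bar>t\<bar>) (transfer t c f)"
  unfolding loglip_def
  using transfer_distortion[OF assms(1,3)] transfer_pos[OF assms] by fastforce

lemma contrD:
  assumes "contr t A f" "0 \<le> A" "x \<in> {0..1}" "y \<in> {0..1}"
  shows "f x - f y \<le> A"
proof -
  have "f x - f y \<le> A * (1 - exp (- 4 * distort t * ldist x y))"
    using assms by (simp add: contr_def)
  also have "\<dots> \<le> A * 1" using assms by (intro mult_left_mono) auto
  finally show ?thesis by simp
qed

lemma contr_bounded:
  assumes "contr t A f" "0 \<le> A"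
  shows "bounded (f ` {0..1})"
proof (rule bounded_imageI)
  fix x :: real assume "x \<in> {0..1}"
  then show "\<bar>f x\<bar> \<le> A + \<bar>f 0\<bar>"
    using contrD[OF assms, of x 0] contrD[OF assms, of 0 x] by auto
qed

lemma contr_of_distortion:
  assumes "\<And>x y. x \<in> {0..1} \<Longrightarrow> y \<in> {0..1} \<Longrightarrow> g x \<le> exp (distort t * ldist x y) * g y"
    and "\<And>x. x \<in> {0..1} \<Longrightarrow> 0 \<le> g x" "\<And>x. x \<in> {0..1} \<Longrightarrow> g x \<le> B"
  shows "contr t B g"
  unfolding contr_def
proof (intro ballI)
  fix x y :: real assume xy: "x \<in> {0..1}" "y \<in> {0..1}"
  have "exp (- distort t * ldist x y) * g x \<le> g y"
    using assms(1)[OF xy] by (simp add: exp_minus field_simps)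
  then have "g x - g y \<le> g x * (1 - exp (- distort t * ldist x y))"
    by (simp add: algebra_simps)
  also have "\<dots> \<le> B * (1 - exp (- 4 * distort t * ldist x y))"
    using assms(2,3)[OF xy(1)] distort_pos[of t] ldist_nonneg[of x y]
    by (intro mult_mono) auto
  finally show "g x - g y \<le> B * (1 - exp (- 4 * distort t * ldist x y))" .
qed

lemma markov_bounds:
  assumes c: "admissible t c" "c 0 > 0" and v: "loglip K v"
    and f: "\<And>z. z \<in> {0..1} \<Longrightarrow> l \<le> f z" "\<And>z. z \<in> {0..1} \<Longrightarrow> f z \<le> u" and x: "x \<in> {0..1}"
  shows "l \<le> markov t c v f x" "markov t c v f x \<le> u"
proof -
  note pos = transfer_pos[OF c v x]
  have v0: "0 \<le> v z" if "z \<in> {0..1}" for z using v that by (simp add: loglip_def less_imp_le)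
  have "bounded (f ` {0..1})"
    by (rule bounded_imageI[where B = "max \<bar>l\<bar> \<bar>u\<bar>"]) (use f in \<open>smt (verit)\<close>)
  then have b: "bounded ((\<lambda>y. v y * f y) ` {0..1})" "bounded ((\<lambda>y. k * v y) ` {0..1})" for k
    using bounded_image_mult[OF loglip_bounded[OF v]] bounded_image_cmult[OF loglip_bounded[OF v], of k] by blast+
  have "transfer t c (\<lambda>y. l * v y) x \<le> transfer t c (\<lambda>y. v y * f y) x"
    by (rule transfer_mono[OF c(1) b(2) b(1) x]) (use f v0 in \<open>auto simp: mult.commute[of "v _"] intro!: mult_right_mono\<close>)
  moreover have "transfer t c (\<lambda>y. v y * f y) x \<le> transfer t c (\<lambda>y. u * v y) x"
    by (rule transfer_mono[OF c(1) b(1) b(2) x]) (use f v0 in \<open>auto simp: mult.commute[of "v _"] intro!: mult_right_mono\<close>)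
  ultimately show "l \<le> markov t c v f x" "markov t c v f x \<le> u"
    using pos by (simp_all add: markov_def transfer_cmult field_simps)
qed

lemma has_sum_diff_real:
  fixes f g :: "'a \<Rightarrow> real"
  assumes "(f has_sum a) A" "(g has_sum b) A"
  shows "((\<lambda>x. f x - g x) has_sum (a - b)) A"
  using has_sum_add[OF assms(1) has_sum_cmult_right[OF assms(2), of "-1"]] by simp

lemma markov_contr:
  assumes c: "admissible t c" "c 0 > 0" and v: "loglip (4 * \<bar>t\<bar>) v"
    and f: "contr t A f" and A: "0 \<le> A"
  shows "contr t (A * rate t) (markov t c v f)"
  unfolding contr_def
proof (intro ballI)
  fix x y :: real assume xy: "x \<in> {0..1}" "y \<in> {0..1}"
  define r where "r = ldist x y"
  define k where "k = exp (- distort t * r)"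
  define p where "p = (\<lambda>x n. c n * branch n x powr (2 * t) * v (branch n x) / transfer t c v x)"
  have vpos: "0 < v z" if "z \<in> {0..1}" for z using v that by (simp add: loglip_def)
  have cn: "0 \<le> c n" for n using c by (simp add: admissible_def)
  have p1: "(p z has_sum 1) UNIV" if "z \<in> {0..1}" for z
    using has_sum_cmult_left[OF transfer_has_sum[OF c(1) loglip_bounded[OF v] that], of "1 / transfer t c v z"]
      transfer_pos[OF c v that] by (simp add: p_def)
  have pM: "((\<lambda>n. p z n * f (branch n z)) has_sum markov t c v f z) UNIV" if "z \<in> {0..1}" for z
    using has_sum_cmult_left[OF transfer_has_sum[OF c(1) bounded_image_mult[OF loglip_bounded[OF v] contr_bounded[OF f A]] that],
        of "1 / transfer t c v z"]
    by (simp add: p_def markov_def mult_ac)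
  have p0: "0 \<le> p z n" if "z \<in> {0..1}" for z n
    unfolding p_def using cn transfer_pos[OF c v that] vpos branch_mem[OF that]
    by (intro divide_nonneg_nonneg mult_nonneg_nonneg) (auto intro: less_imp_le)
  obtain S where S: "\<And>z. z \<in> {0..1} \<Longrightarrow> f z \<le> S" "\<And>z. z \<in> {0..1} \<Longrightarrow> S - A \<le> f z"
  proof
    fix z :: real assume z: "z \<in> {0..1}"
    show "f z \<le> Sup (f ` {0..1})"
      using contr_bounded[OF f A] z by (intro cSUP_upper bounded_imp_bdd_above)
    have "Sup (f ` {0..1}) \<le> f z + A"
      by (rule cSUP_least) (use contrD[OF f A _ z] in \<open>auto simp: algebra_simps\<close>)
    then show "Sup (f ` {0..1}) - A \<le> f z" by simp
  qed
  have r: "0 \<le> r" "r \<le> ln 2" using ldist_nonneg ldist_le[OF xy] by (auto simp: r_def)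
  have k: "0 < k" "k \<le> 1" "exp (- distort t * ln 2) \<le> k"
    using r distort_pos[of t] by (auto simp: k_def)
  \<comment> \<open>Couple the two transition probabilities: with mass \<open>k\<close> both points follow the same branch and
    their distance is halved, and the remaining mass \<open>1 - k\<close> contributes at most the oscillation \<open>A\<close>.\<close>
  have kp: "k * p y n \<le> p x n" for n
  proof -
    have "v (branch n y) \<le> exp (4 * \<bar>t\<bar> * ldist (branch n y) (branch n x)) * v (branch n x)"
      using v branch_mem xy by (simp add: loglip_def)
    also have "\<dots> \<le> exp (4 * \<bar>t\<bar> * (r / 2)) * v (branch n x)"
      using mult_left_mono[OF ldist_branch[OF xy, of n], of "4 * \<bar>t\<bar>"] vpos[OF branch_mem[OF xy(1), of n]]
      by (intro mult_right_mono) (auto simp: r_def ldist_commute)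
    finally have 1: "v (branch n y) \<le> exp (2 * \<bar>t\<bar> * r) * v (branch n x)" by (simp add: mult_ac)
    have 2: "branch n y powr (2 * t) \<le> exp (2 * \<bar>t\<bar> * r) * branch n x powr (2 * t)"
      using branch_powr_le[OF xy(2,1)] by (simp add: r_def ldist_commute)
    have 3: "transfer t c v x \<le> exp (4 * \<bar>t\<bar> * r) * transfer t c v y"
      using transfer_distortion[OF c(1) v xy] by (simp add: r_def)
    have "c n * (branch n y powr (2 * t) * v (branch n y)) * transfer t c v x \<le>
       c n * ((exp (2 * \<bar>t\<bar> * r) * branch n x powr (2 * t)) * (exp (2 * \<bar>t\<bar> * r) * v (branch n x)))
         * (exp (4 * \<bar>t\<bar> * r) * transfer t c v y)"
      using cn[of n] vpos[OF branch_mem[OF xy(2), of n]] vpos[OF branch_mem[OF xy(1), of n]]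
        transfer_pos[OF c v xy(1)]
      by (intro mult_mono mult_left_mono 1 2 3 mult_nonneg_nonneg) auto
    also have "\<dots> = exp (8 * \<bar>t\<bar> * r) * (c n * branch n x powr (2 * t) * v (branch n x) * transfer t c v y)"
    proof -
      have "exp (8 * \<bar>t\<bar> * r) = exp (2 * \<bar>t\<bar> * r) * exp (2 * \<bar>t\<bar> * r) * exp (4 * \<bar>t\<bar> * r)"
        by (simp flip: exp_add add: algebra_simps)
      then show ?thesis by (simp add: mult_ac)
    qed
    also have "\<dots> \<le> exp (distort t * r) * (c n * branch n x powr (2 * t) * v (branch n x) * transfer t c v y)"
      using cn[of n] vpos[OF branch_mem[OF xy(1), of n]] transfer_pos[OF c v xy(2)] r
      by (intro mult_right_mono mult_nonneg_nonneg) (auto simp: distort_def mult_right_mono)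
    finally show ?thesis
      using transfer_pos[OF c v xy(1)] transfer_pos[OF c v xy(2)]
      by (simp add: p_def k_def exp_minus field_simps)
  qed
  have E: "f (branch n x) - f (branch n y) \<le> A * (1 - k ^ 2)" for n
  proof -
    have "f (branch n x) - f (branch n y) \<le> A * (1 - exp (- 4 * distort t * ldist (branch n x) (branch n y)))"
      using f branch_mem xy by (simp add: contr_def)
    also have "\<dots> \<le> A * (1 - exp (- 4 * distort t * (r / 2)))"
      using mult_left_mono[OF ldist_branch[OF xy, of n], of "4 * distort t"] A distort_pos[of t]
      by (intro mult_left_mono diff_left_mono) (auto simp: r_def)
    also have "exp (- 4 * distort t * (r / 2)) = k ^ 2"
      by (simp add: k_def flip: exp_of_nat_mult)
    finally show ?thesis .
  qed
  have "markov t c v f x - markov t c v f y \<le> k * (A * (1 - k ^ 2)) * 1 + (1 - k * 1) * S - (1 - k) * (S - A) * 1"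
  proof (rule has_sum_mono)
    show "((\<lambda>n. p x n * f (branch n x) - p y n * f (branch n y)) has_sum
        (markov t c v f x - markov t c v f y)) UNIV"
      by (intro has_sum_diff_real pM xy)
    show "((\<lambda>n. k * (A * (1 - k ^ 2)) * p y n + (p x n - k * p y n) * S - (1 - k) * (S - A) * p y n)
       has_sum (k * (A * (1 - k ^ 2)) * 1 + (1 - k * 1) * S - (1 - k) * (S - A) * 1)) UNIV"
      by (intro has_sum_diff_real has_sum_add has_sum_cmult_right has_sum_cmult_left p1 xy)
    fix n
    have "k * p y n * (f (branch n x) - f (branch n y)) \<le> k * p y n * (A * (1 - k ^ 2))"
      using k p0 xy E by (intro mult_left_mono) auto
    moreover have "(p x n - k * p y n) * f (branch n x) \<le> (p x n - k * p y n) * S"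
      using kp S branch_mem xy by (intro mult_left_mono) auto
    moreover have "(1 - k) * p y n * (S - A) \<le> (1 - k) * p y n * f (branch n y)"
      using k p0 S branch_mem xy by (intro mult_left_mono) auto
    ultimately show "p x n * f (branch n x) - p y n * f (branch n y) \<le>
       k * (A * (1 - k ^ 2)) * p y n + (p x n - k * p y n) * S - (1 - k) * (S - A) * p y n"
      by (simp add: algebra_simps)
  qed
  also have "\<dots> = A * (1 - k ^ 3)" by (simp add: algebra_simps power2_eq_square power3_eq_cube)
  also have "\<dots> \<le> A * (rate t * (1 - k ^ 4))"
  proof (rule mult_left_mono[OF _ A])
    define k0 where "k0 = exp (- distort t * ln 2)"
    have k0: "0 \<le> k0" "k0 \<le> k" using k by (auto simp: k0_def)
    have "k0 ^ 3 * ((1 + k + k ^ 2 + k ^ 3) / 4) \<le> k ^ 3 * 1"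
    proof (rule mult_mono)
      have "k ^ 2 \<le> 1" "k ^ 3 \<le> 1" using k by (auto intro: power_le_one)
      then show "(1 + k + k ^ 2 + k ^ 3) / 4 \<le> 1" using k by simp
    qed (use k k0 in \<open>auto intro: power_mono\<close>)
    then have "(1 - k) * (k0 ^ 3 * ((1 + k + k ^ 2 + k ^ 3) / 4)) \<le> (1 - k) * (k ^ 3 * 1)"
      using k by (intro mult_left_mono) auto
    then have "1 - k ^ 3 \<le> (1 - k0 ^ 3 / 4) * (1 - k ^ 4)"
      by (simp add: algebra_simps eval_nat_numeral)
    moreover have "rate t = 1 - k0 ^ 3 / 4" by (simp only: rate_def k0_def)
    ultimately show "1 - k ^ 3 \<le> rate t * (1 - k ^ 4)" by simp
  qed
  also have "k ^ 4 = exp (- 4 * distort t * ldist x y)"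
    by (simp add: k_def r_def mult_ac flip: exp_of_nat_mult)
  finally show "markov t c v f x - markov t c v f y \<le> A * rate t * (1 - exp (- 4 * distort t * ldist x y))"
    by (simp add: mult.assoc)
qed

lemma markov_iterates_converge:
  assumes c: "admissible t c" "c 0 > 0" and v: "\<And>n. loglip (4 * \<bar>t\<bar>) (v n)"
    and g0: "contr t A (g 0)" and A: "0 \<le> A"
    and gS: "\<And>n x. x \<in> {0..1} \<Longrightarrow> g (Suc n) x = markov t c (v n) (g n) x"
  obtains D where "\<And>n x. x \<in> {0..1} \<Longrightarrow> \<bar>g n x - D\<bar> \<le> A * rate t ^ n"
proof -
  note rate = rate_bounds[of t]
  have contr: "contr t (A * rate t ^ n) (g n)" for n
  proof (induction n)
    case (Suc n)
    have "contr t (A * rate t ^ n * rate t) (markov t c (v n) (g n))"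
      using Suc A rate by (intro markov_contr c v) auto
    then show ?case using gS[of _ n] unfolding contr_def by (simp add: mult_ac)
  qed (use g0 in simp)
  have near: "\<forall>y\<in>{0..1}. g n x - A * rate t ^ n \<le> g (n + k) y \<and> g (n + k) y \<le> g n x + A * rate t ^ n"
    if x: "x \<in> {0..1}" for n k x
  proof (induction k)
    case 0
    have A': "0 \<le> A * rate t ^ n" using A rate by simp
    show ?case using contrD[OF contr A' x] contrD[OF contr A' _ x] by (auto simp: algebra_simps)
  next
    case (Suc k)
    then show ?case
      using markov_bounds[OF c v[of "n + k"], of "g n x - A * rate t ^ n" "g (n + k)" "g n x + A * rate t ^ n"]
      by (simp add: gS)
  qed
  have tend: "(\<lambda>n. A * rate t ^ n) \<longlonglongrightarrow> 0"
    using tendsto_mult_right[OF LIMSEQ_realpow_zero[of "rate t"], of A] rate by (simp add: mult.commute)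
  have "Cauchy (\<lambda>n. g n 0)"
  proof (rule CauchyI')
    fix e :: real assume "0 < e"
    then have "\<forall>\<^sub>F n in sequentially. A * rate t ^ n < e"
      using order_tendstoD(2)[OF tend] by simp
    then obtain M where M: "A * rate t ^ n < e" if "n \<ge> M" for n
      by (auto simp: eventually_sequentially)
    show "\<exists>M. \<forall>m\<ge>M. \<forall>n>m. dist (g m 0) (g n 0) < e"
    proof (intro exI allI impI)
      fix m n :: nat assume "m \<ge> M" "n > m"
      then show "dist (g m 0) (g n 0) < e"
        using near[of 0 m "n - m"] M[of m] by (auto simp: dist_real_def abs_less_iff dest!: bspec[of _ _ 0])
    qed
  qed
  then obtain D where D: "(\<lambda>n. g n 0) \<longlonglongrightarrow> D"
    using Cauchy_convergent_iff convergent_def by blast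
  show ?thesis
  proof (rule that)
    fix n and x :: real assume x: "x \<in> {0..1}"
    have "g n x - A * rate t ^ n \<le> g (n + k) 0" "g (n + k) 0 \<le> g n x + A * rate t ^ n" for k
      using near[OF x, of n k] by auto
    moreover have "(\<lambda>k. g (n + k) 0) \<longlonglongrightarrow> D"
      using LIMSEQ_ignore_initial_segment[OF D, of n] by (simp add: add.commute)
    ultimately have "g n x - A * rate t ^ n \<le> D" "D \<le> g n x + A * rate t ^ n"
      by (auto intro: LIMSEQ_le_const LIMSEQ_le_const2)
    then show "\<bar>g n x - D\<bar> \<le> A * rate t ^ n" by simp
  qed
qed

lemma transfer_eigenfunction:
  assumes c: "admissible t c" "c 0 > 0"
  obtains r h where "0 < r" "loglip (4 * \<bar>t\<bar>) h"
    "\<And>x. x \<in> {0..1} \<Longrightarrow> transfer t c h x = r * h x"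
proof -
  define f where "f n = (transfer t c ^^ n) (\<lambda>_. 1)" for n
  define R where "R n x = f (Suc n) x / f n x" for n x
  have fS: "f (Suc n) = transfer t c (f n)" for n by (simp add: f_def)
  have f: "loglip (4 * \<bar>t\<bar>) (f n)" for n
  proof (induction n)
    case 0
    show ?case by (simp add: f_def loglip_def ldist_nonneg)
  next
    case (Suc n)
    then show ?case by (simp add: fS transfer_loglip c)
  qed
  have fpos: "0 < f n x" if "x \<in> {0..1}" for n x using f[of n] that by (simp add: loglip_def)
  have RS: "R (Suc n) x = markov t c (f n) (R n) x" if x: "x \<in> {0..1}" for n x
  proof -
    have "transfer t c (\<lambda>y. f n y * R n y) x = transfer t c (f (Suc n)) x"
      by (rule transfer_cong[OF x]) (use fpos in \<open>simp add: R_def less_imp_neq[symmetric]\<close>)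
    then show ?thesis by (simp add: markov_def R_def fS)
  qed
  have f1: "loglip (4 * \<bar>t\<bar>) (R 0)" 
  proof -
    have "R 0 = f 1" by (simp add: R_def f_def fun_eq_iff)
    then show ?thesis using f[of 1] by simp
  qed
  obtain m A where m: "0 < m" "\<And>x. x \<in> {0..1} \<Longrightarrow> m \<le> R 0 x" and A: "\<And>x. x \<in> {0..1} \<Longrightarrow> R 0 x \<le> A"
    using loglip_bounds[OF f1] by blast
  have A0: "0 \<le> A" using m(1) A[of 0] m(2)[of 0] by simp
  have "contr t A (R 0)"
  proof (rule contr_of_distortion)
    fix x y :: real assume xy: "x \<in> {0..1}" "y \<in> {0..1}"
    have "R 0 x \<le> exp (4 * \<bar>t\<bar> * ldist x y) * R 0 y" using f1 xy by (simp add: loglip_def)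
    also have "\<dots> \<le> exp (distort t * ldist x y) * R 0 y"
      using m(1) m(2)[OF xy(2)] ldist_nonneg[of x y]
      by (intro mult_right_mono) (auto simp: distort_def intro!: mult_right_mono)
    finally show "R 0 x \<le> exp (distort t * ldist x y) * R 0 y" .
  qed (use m A in \<open>auto intro: order_trans less_imp_le\<close>)
  then obtain D where D: "\<And>n x. x \<in> {0..1} \<Longrightarrow> \<bar>R n x - D\<bar> \<le> A * rate t ^ n"
    using markov_iterates_converge[where v = f and g = R, OF c f _ A0] RS by blast
  have Rm: "\<forall>x\<in>{0..1}. m \<le> R n x \<and> R n x \<le> A" for n
  proof (induction n)
    case 0
    show ?case using m A by auto
  next
    case (Suc n)
    then show ?case using markov_bounds[OF c f, of m "R n" A] RS by auto
  qed
  note rate = rate_bounds[of t]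
  have tend: "(\<lambda>n. A * rate t ^ n) \<longlonglongrightarrow> 0"
    using tendsto_mult_right[OF LIMSEQ_realpow_zero[of "rate t"], of A] rate by (simp add: mult.commute)
  have "m \<le> D"
  proof (rule LIMSEQ_le_const[where X = "\<lambda>n. D + A * rate t ^ n"])
    show "(\<lambda>n. D + A * rate t ^ n) \<longlonglongrightarrow> D"
      using tendsto_add[OF tendsto_const tend, of D] by simp
    have "m \<le> D + A * rate t ^ n" for n
      using D[of 0 n] Rm[of n] by force
    then show "\<exists>N. \<forall>n\<ge>N. m \<le> D + A * rate t ^ n" by blast
  qed
  with m(1) have D0: "0 < D" by simp
  have lnR: "\<bar>ln (R n x / D)\<bar> \<le> A / m * rate t ^ n" if x: "x \<in> {0..1}" for n x
  proof -
    have R: "m \<le> R n x" using Rm x by auto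
    have abs: "\<bar>R n x - D\<bar> / z \<le> A / m * rate t ^ n" if "m \<le> z" for z
    proof -
      have "\<bar>R n x - D\<bar> / z \<le> \<bar>R n x - D\<bar> / m" using m(1) that by (intro divide_left_mono) auto
      also have "\<dots> \<le> A / m * rate t ^ n" using D[OF x, of n] m(1) by (simp add: divide_right_mono)
      finally show ?thesis .
    qed
    have "ln (R n x / D) \<le> R n x / D - 1" using R m(1) D0 by (intro ln_le_minus_one) auto
    also have "\<dots> \<le> \<bar>R n x - D\<bar> / D" 
      using D0 divide_right_mono[of "R n x - D" "\<bar>R n x - D\<bar>" D] by (simp add: diff_divide_distrib)
    also note abs[OF \<open>m \<le> D\<close>]
    finally have 1: "ln (R n x / D) \<le> A / m * rate t ^ n" .
    have "- ln (R n x / D) = ln (D / R n x)" using R m(1) D0 by (simp add: ln_div)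
    also have "\<dots> \<le> D / R n x - 1" using R m(1) D0 by (intro ln_le_minus_one) auto
    also have "\<dots> \<le> \<bar>R n x - D\<bar> / R n x" 
      using R m(1) divide_right_mono[of "D - R n x" "\<bar>R n x - D\<bar>" "R n x"] by (simp add: diff_divide_distrib)
    also note abs[OF R]
    finally show ?thesis using 1 by simp
  qed
  define h where "h x = exp (\<Sum>j. ln (R j x / D))" for x
  define e where "e n = A / m * rate t ^ n / (1 - rate t)" for n
  have geo: "(\<lambda>j. A / m * rate t ^ (j + n)) sums e n" for n
    using sums_mult[OF geometric_sums[of "rate t"], of "A / m * rate t ^ n"] rate
    by (simp add: e_def power_add mult_ac)
  have e0: "e \<longlonglongrightarrow> 0"
    using tendsto_mult_right[OF tend, of "1 / (m * (1 - rate t))"] by (simp add: e_def[abs_def] mult_ac)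
  have summ: "summable (\<lambda>j. ln (R j x / D))" if x: "x \<in> {0..1}" for x
    by (rule summable_comparison_test[OF _ sums_summable[OF geo[of 0]]]) (use lnR[OF x] in auto)
  have part: "exp (\<Sum>j<n. ln (R j x / D)) = f n x / D ^ n" if x: "x \<in> {0..1}" for n x
  proof (induction n)
    case (Suc n)
    have "0 < R n x / D" using fpos[OF x] D0 by (simp add: R_def)
    then show ?case using Suc fpos[OF x, of n] by (simp add: exp_add R_def)
  qed (simp add: f_def)
  have near: "f n x / D ^ n * exp (- e n) \<le> h x" "h x \<le> f n x / D ^ n * exp (e n)"
    if x: "x \<in> {0..1}" for n x
  proof -
    have "\<bar>\<Sum>j. ln (R (j + n) x / D)\<bar> \<le> e n"
    proof (rule order_trans[OF summable_rabs])
      show abs: "summable (\<lambda>j. \<bar>ln (R (j + n) x / D)\<bar>)"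
        by (rule summable_comparison_test[OF _ sums_summable[OF geo[of n]]]) (use lnR[OF x] in auto)
      show "(\<Sum>j. \<bar>ln (R (j + n) x / D)\<bar>) \<le> e n"
        using suminf_le[OF _ abs sums_summable[OF geo[of n]]] lnR[OF x] sums_unique[OF geo[of n]] by auto
    qed
    moreover have "h x = f n x / D ^ n * exp (\<Sum>j. ln (R (j + n) x / D))"
      unfolding h_def part[OF x, symmetric] exp_add[symmetric]
      by (subst suminf_split_initial_segment[OF summ[OF x], of n]) (simp add: add.commute)
    moreover have "0 < f n x / D ^ n" using fpos[OF x] D0 by simp
    ultimately show "f n x / D ^ n * exp (- e n) \<le> h x" "h x \<le> f n x / D ^ n * exp (e n)"
      by (auto simp del: times_divide_eq_left intro!: mult_left_mono)
  qed
  have lim: "(\<lambda>n. f n x / D ^ n) \<longlonglongrightarrow> h x" if x: "x \<in> {0..1}" for x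
    using tendsto_exp[OF summable_LIMSEQ[OF summ[OF x]]] by (simp add: part[OF x] h_def)
  have h: "loglip (4 * \<bar>t\<bar>) h"
    unfolding loglip_def
  proof (intro conjI ballI)
    fix x y :: real assume xy: "x \<in> {0..1}" "y \<in> {0..1}"
    show "h x \<le> exp (4 * \<bar>t\<bar> * ldist x y) * h y"
    proof (rule LIMSEQ_le[OF lim[OF xy(1)] tendsto_mult_left[OF lim[OF xy(2)]]])
      have "f n x / D ^ n \<le> exp (4 * \<bar>t\<bar> * ldist x y) * (f n y / D ^ n)" for n
        using f[of n] xy D0 by (simp add: loglip_def divide_right_mono)
      then show "\<exists>N. \<forall>n\<ge>N. f n x / D ^ n \<le> exp (4 * \<bar>t\<bar> * ldist x y) * (f n y / D ^ n)" by blast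
    qed
  qed (simp add: h_def)
  have "transfer t c h x = D * h x" if x: "x \<in> {0..1}" for x
  proof -
    have scaled: "transfer t c (\<lambda>y. k * f n y) x = k * f (Suc n) x" for k n
      by (simp add: transfer_cmult fS)
    have bdd: "bounded ((\<lambda>y. k * f n y) ` {0..1})" for k n
      by (rule bounded_image_cmult[OF loglip_bounded[OF f]])
    have low: "exp (- e n) / D ^ n * f (Suc n) x \<le> transfer t c h x" for n
      unfolding scaled[symmetric]
      by (rule transfer_mono[OF c(1) bdd loglip_bounded[OF h] x]) (use near(1) in \<open>simp add: mult.commute\<close>)
    have up: "transfer t c h x \<le> exp (e n) / D ^ n * f (Suc n) x" for n
      unfolding scaled[symmetric]
      by (rule transfer_mono[OF c(1) loglip_bounded[OF h] bdd x]) (use near(2) in \<open>simp add: mult.commute\<close>)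
    have l: "(\<lambda>n. D * (f (Suc n) x / D ^ Suc n)) \<longlonglongrightarrow> D * h x"
      by (intro tendsto_mult_left LIMSEQ_Suc lim[OF x])
    have e1: "(\<lambda>n. exp (e n)) \<longlonglongrightarrow> 1" "(\<lambda>n. exp (- e n)) \<longlonglongrightarrow> 1"
      using tendsto_exp[OF e0] tendsto_exp[OF tendsto_minus[OF e0]] by auto
    have "(\<lambda>n. exp (e n) / D ^ n * f (Suc n) x) \<longlonglongrightarrow> D * h x"
         "(\<lambda>n. exp (- e n) / D ^ n * f (Suc n) x) \<longlonglongrightarrow> D * h x"
      using tendsto_mult[OF e1(1) l] tendsto_mult[OF e1(2) l] D0 by (auto simp: field_simps)
    then have "transfer t c h x \<le> D * h x" "D * h x \<le> transfer t c h x"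
      using low up by (auto intro: LIMSEQ_le_const LIMSEQ_le_const2)
    then show ?thesis by simp
  qed
  with D0 h show ?thesis by (rule that)
qed

section \<open>Pressure and eigenvalues\<close>

definition digit_powr :: "real \<Rightarrow> nat \<Rightarrow> real" where
  "digit_powr q n = real (Suc n) powr q"

definition word_weight :: "real \<Rightarrow> real \<Rightarrow> nat list \<Rightarrow> real \<Rightarrow> real" where
  "word_weight t q ws x = (\<Prod>j<length ws. real (ws ! j) powr q * cfrac (drop j ws) x powr (2 * t))"

lemma digit_powr_pos: "0 < digit_powr q n"
  by (simp add: digit_powr_def)

lemma digit_powr_add: "digit_powr (q + s) n = digit_powr q n * digit_powr s n"
  by (simp add: digit_powr_def powr_add)

lemma digit_powr_summable: "q < - 1 \<Longrightarrow> digit_powr q summable_on UNIV"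
  by (rule summable_nonneg_imp_summable_on)
    (simp_all add: digit_powr_def[abs_def] summable_real_powr_iff summable_Suc_iff[of "\<lambda>n. real n powr q"]
      del: of_nat_Suc)

lemma digit_powr_admissible:
  assumes "2 * t - q > 1"
  shows "admissible t (digit_powr q)"
proof -
  have "digit_powr q n * real (Suc n) powr (- 2 * t) = digit_powr (q + - 2 * t) n" for n
    unfolding digit_powr_add by (simp add: digit_powr_def)
  then show ?thesis
    using digit_powr_summable[of "q + - 2 * t"] assms digit_powr_pos[of q]
    by (simp add: admissible_def less_imp_le)
qed

lemma zeta_has_sum:
  assumes "s > 1" shows "(digit_powr (- s) has_sum zeta s) UNIV"
proof -
  have "summable (digit_powr (- s))"
    using assms by (simp add: digit_powr_def[abs_def] summable_real_powr_iff
        summable_Suc_iff[of "\<lambda>n. real n powr (- s)"] del: of_nat_Suc)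
  then show ?thesis
    unfolding zeta_def using sums_nonneg_imp_has_sum[OF summable_sums] digit_powr_pos
    by (metis digit_powr_def less_imp_le suminf_cong)
qed

lemma cfrac_snoc: "cfrac (ws @ [w]) x = cfrac ws (1 / (real w + x))"
  by (induction ws) auto

lemma word_weight_snoc:
  "word_weight t q (ws @ [Suc n]) x
    = digit_powr q n * branch n x powr (2 * t) * word_weight t q ws (branch n x)"
proof -
  have "(\<Prod>j<length ws. real ((ws @ [Suc n]) ! j) powr q * cfrac (drop j (ws @ [Suc n])) x powr (2 * t))
      = word_weight t q ws (branch n x)"
    unfolding word_weight_def
    by (rule prod.cong) (auto simp: nth_append cfrac_snoc branch_def)
  then show ?thesis
    by (simp add: word_weight_def[of _ _ "ws @ [Suc n]"] digit_powr_def branch_def mult_ac)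
qed

lemma words_0: "words 0 = {[]}"
  by (auto simp: words_def)

lemma words_Suc: "words (Suc m) = (\<lambda>(n, ws). ws @ [Suc n]) ` (UNIV \<times> words m)"
proof (intro set_eqI iffI)
  fix us assume us: "us \<in> words (Suc m)"
  then obtain ws w where eq: "us = ws @ [w]"
    by (cases us rule: rev_cases) (auto simp: words_def)
  with us have "w \<ge> 1" "ws \<in> words m" by (auto simp: words_def)
  then show "us \<in> (\<lambda>(n, ws). ws @ [Suc n]) ` (UNIV \<times> words m)"
    unfolding eq by (intro image_eqI[of _ _ "(w - 1, ws)"]) auto
qed (auto simp: words_def)

lemma word_weight_loglip:
  assumes "\<forall>w\<in>set ws. w \<ge> 1"
  shows "loglip (4 * \<bar>t\<bar>) (word_weight t q ws)"
  using assms
proof (induction ws rule: rev_induct)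
  case Nil
  then show ?case by (simp add: loglip_def word_weight_def ldist_nonneg)
next
  case (snoc w ws)
  define W where "W = word_weight t q ws"
  from snoc have W: "loglip (4 * \<bar>t\<bar>) W" and w: "w = Suc (w - 1)" by (auto simp: W_def)
  have eq: "word_weight t q (ws @ [w]) x
      = digit_powr q (w - 1) * branch (w - 1) x powr (2 * t) * W (branch (w - 1) x)" for x
    by (subst w, subst word_weight_snoc) (simp add: W_def)
  have Wpos: "0 < W (branch (w - 1) x)" if "x \<in> {0..1}" for x
    using W branch_mem[OF that] by (simp add: loglip_def)
  show ?case
    unfolding loglip_def eq
  proof (intro conjI ballI)
    fix x :: real assume x: "x \<in> {0..1}"
    show "0 < digit_powr q (w - 1) * branch (w - 1) x powr (2 * t) * W (branch (w - 1) x)"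
      using branch_pos[OF x, of "w - 1"] digit_powr_pos[of q "w - 1"] Wpos[OF x]
      by (intro mult_pos_pos) auto
  next
    fix x y :: real assume xy: "x \<in> {0..1}" "y \<in> {0..1}"
    have "W (branch (w - 1) x) \<le> exp (4 * \<bar>t\<bar> * ldist (branch (w - 1) x) (branch (w - 1) y)) * W (branch (w - 1) y)"
      using W branch_mem xy by (simp add: loglip_def)
    also have "\<dots> \<le> exp (4 * \<bar>t\<bar> * (ldist x y / 2)) * W (branch (w - 1) y)"
      using Wpos[OF xy(2)] mult_left_mono[OF ldist_branch[OF xy, of "w - 1"], of "4 * \<bar>t\<bar>"]
      by (intro mult_right_mono) auto
    finally have "W (branch (w - 1) x) \<le> exp (4 * \<bar>t\<bar> * (ldist x y / 2)) * W (branch (w - 1) y)" .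
    then have "digit_powr q (w - 1) * (branch (w - 1) x powr (2 * t) * W (branch (w - 1) x)) \<le>
        digit_powr q (w - 1) * ((exp (2 * \<bar>t\<bar> * ldist x y) * branch (w - 1) y powr (2 * t)) *
          (exp (4 * \<bar>t\<bar> * (ldist x y / 2)) * W (branch (w - 1) y)))"
      using Wpos[OF xy(1)] digit_powr_pos[of q "w - 1"]
      by (intro mult_left_mono mult_mono branch_powr_le xy) auto
    also have "\<dots> = (exp (2 * \<bar>t\<bar> * ldist x y) * exp (4 * \<bar>t\<bar> * (ldist x y / 2))) *
        (digit_powr q (w - 1) * branch (w - 1) y powr (2 * t) * W (branch (w - 1) y))"
      by (simp only: mult_ac)
    also have "exp (2 * \<bar>t\<bar> * ldist x y) * exp (4 * \<bar>t\<bar> * (ldist x y / 2)) = exp (4 * \<bar>t\<bar> * ldist x y)"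
      by (simp flip: exp_add)
    finally show "digit_powr q (w - 1) * branch (w - 1) x powr (2 * t) * W (branch (w - 1) x) \<le>
        exp (4 * \<bar>t\<bar> * ldist x y) * (digit_powr q (w - 1) * branch (w - 1) y powr (2 * t) * W (branch (w - 1) y))"
      by (simp only: mult.assoc)
  qed
qed

lemma transfer_power_loglip:
  assumes "admissible t c" "c 0 > 0"
  shows "loglip (4 * \<bar>t\<bar>) ((transfer t c ^^ n) (\<lambda>_. 1))"
proof (induction n)
  case 0
  show ?case by (simp add: loglip_def ldist_nonneg)
next
  case (Suc n)
  then show ?case by (simp add: transfer_loglip assms)
qed

lemma word_weight_has_sum:
  assumes tq: "2 * t - q > 1" and x: "x \<in> {0..1}"
  shows "(((\<lambda>ws. word_weight t q ws x)) has_sum (transfer t (digit_powr q) ^^ m) (\<lambda>_. 1) x) (words m)"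
  using x
proof (induction m arbitrary: x)
  case 0
  show ?case by (simp add: words_0 word_weight_def has_sum_finite_iff)
next
  case (Suc m)
  let ?f = "(transfer t (digit_powr q) ^^ m) (\<lambda>_. 1)"
  let ?g = "\<lambda>(n, ws). digit_powr q n * branch n x powr (2 * t) * word_weight t q ws (branch n x)"
  note adm = digit_powr_admissible[OF tq]
  have inner: "((\<lambda>ws. ?g (n, ws)) has_sum (digit_powr q n * branch n x powr (2 * t) * ?f (branch n x))) (words m)" for n
    using has_sum_cmult_right[OF Suc.IH[OF branch_mem[OF Suc.prems]]] by simp
  have outer: "((\<lambda>n. digit_powr q n * branch n x powr (2 * t) * ?f (branch n x)) has_sum transfer t (digit_powr q) ?f x) UNIV"
    by (rule transfer_has_sum[OF adm loglip_bounded[OF transfer_power_loglip[OF adm digit_powr_pos]] Suc.prems])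
  have nonneg: "0 \<le> ?g (n, ws)" if "ws \<in> words m" for n ws
    using word_weight_loglip[of ws t q] branch_mem[OF Suc.prems, of n] that digit_powr_pos[of q n]
    by (auto simp: loglip_def words_def less_imp_le)
  have "(?g has_sum transfer t (digit_powr q) ?f x) (UNIV \<times> words m)"
    using inner outer
    by (rule has_sum_SigmaI) (rule summable_on_SigmaI[OF inner has_sum_imp_summable[OF outer] nonneg])
  moreover have "?g = (\<lambda>ws. word_weight t q ws x) \<circ> (\<lambda>(n, ws). ws @ [Suc n])"
    by (auto simp: word_weight_snoc)
  moreover have "inj_on (\<lambda>(n, ws). ws @ [Suc n]) (UNIV \<times> words m)"
    by (auto simp: inj_on_def)
  ultimately show ?case by (simp add: words_Suc has_sum_reindex)
qed

lemma partition_sum_bounds: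
  assumes tq: "2 * t - q > 1"
  defines "f \<equiv> \<lambda>n. (transfer t (digit_powr q) ^^ n) (\<lambda>_. 1) (0 :: real)"
  shows "f n \<le> partition_sum t q n" "partition_sum t q n \<le> exp (4 * \<bar>t\<bar> * ln 2) * f n"
proof -
  define S where "S ws = exp (SUP x\<in>{0..1}. ln (word_weight t q ws x))" for ws
  have eq: "partition_sum t q n = infsum S (words n)"
    unfolding partition_sum_def S_def word_weight_def
    by (rule infsum_cong) (auto simp: words_def)
  have bounds: "word_weight t q ws 0 \<le> S ws \<and> S ws \<le> exp (4 * \<bar>t\<bar> * ln 2) * word_weight t q ws 0"
    if "ws \<in> words n" for ws
  proof -
    have W: "loglip (4 * \<bar>t\<bar>) (word_weight t q ws)"
      using that by (intro word_weight_loglip) (auto simp: words_def)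
    then have pos: "0 < word_weight t q ws x" if "x \<in> {0..1}" for x
      using that by (simp add: loglip_def)
    have le: "ln (word_weight t q ws x) \<le> 4 * \<bar>t\<bar> * ln 2 + ln (word_weight t q ws 0)"
      if x: "x \<in> {0..1}" for x
    proof -
      have "word_weight t q ws x \<le> exp (4 * \<bar>t\<bar> * ldist x 0) * word_weight t q ws 0"
        using W x by (simp add: loglip_def)
      also have "\<dots> \<le> exp (4 * \<bar>t\<bar> * ln 2) * word_weight t q ws 0"
        using pos[of 0] ldist_le[OF x, of 0] by (intro mult_right_mono) (auto intro: mult_left_mono)
      finally have "ln (word_weight t q ws x) \<le> ln (exp (4 * \<bar>t\<bar> * ln 2) * word_weight t q ws 0)"
        using pos[OF x] pos[of 0] by simp
      also have "\<dots> = 4 * \<bar>t\<bar> * ln 2 + ln (word_weight t q ws 0)"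
        using pos[of 0] by (simp add: ln_mult)
      finally show ?thesis .
    qed
    have "ln (word_weight t q ws 0) \<le> (SUP x\<in>{0..1}. ln (word_weight t q ws x))"
      using le by (intro cSUP_upper bdd_aboveI2) auto
    moreover have "(SUP x\<in>{0..1}. ln (word_weight t q ws x)) \<le> 4 * \<bar>t\<bar> * ln 2 + ln (word_weight t q ws 0)"
      using le by (intro cSUP_least) auto
    ultimately have "exp (ln (word_weight t q ws 0)) \<le> S ws"
      "S ws \<le> exp (4 * \<bar>t\<bar> * ln 2 + ln (word_weight t q ws 0))"
      by (simp_all add: S_def)
    then show ?thesis using pos[of 0] by (simp add: exp_add)
  qed
  have sum: "((\<lambda>ws. word_weight t q ws 0) has_sum f n) (words n)"
    unfolding f_def by (rule word_weight_has_sum[OF tq]) simp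
  note sum2 = has_sum_cmult_right[OF sum, of "exp (4 * \<bar>t\<bar> * ln 2)"]
  have "S summable_on words n"
    by (rule summable_on_comparison_test[OF has_sum_imp_summable[OF sum2]]) (use bounds in \<open>auto simp: S_def\<close>)
  then have "(S has_sum partition_sum t q n) (words n)"
    unfolding eq by (rule has_sum_infsum)
  then show "f n \<le> partition_sum t q n" "partition_sum t q n \<le> exp (4 * \<bar>t\<bar> * ln 2) * f n"
    using has_sum_mono[OF sum] has_sum_mono[OF _ sum2] bounds by blast+
qed

lemma transfer_power_le:
  assumes c: "admissible t c" "c 0 > 0" and \<mu>: "0 < \<mu>" and m: "0 < m"
    and F: "\<And>x. x \<in> {0..1} \<Longrightarrow> m \<le> F x" "bounded (F ` {0..1})"
    and sub: "\<And>x. x \<in> {0..1} \<Longrightarrow> transfer t c F x \<le> \<mu> * F x"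
    and x: "x \<in> {0..1}"
  shows "(transfer t c ^^ n) (\<lambda>_. 1) x \<le> \<mu> ^ n / m * F x"
  using x
proof (induction n arbitrary: x)
  case 0
  then show ?case using F(1) m by simp
next
  case (Suc n)
  have "(transfer t c ^^ Suc n) (\<lambda>_. 1) x \<le> transfer t c (\<lambda>y. \<mu> ^ n / m * F y) x"
    unfolding funpow.simps comp_def
    by (rule transfer_mono[OF c(1) loglip_bounded[OF transfer_power_loglip[OF c]] bounded_image_cmult[OF F(2)] Suc.prems Suc.IH])
  also have "\<dots> \<le> \<mu> ^ n / m * (\<mu> * F x)"
    unfolding transfer_cmult using sub[OF Suc.prems] \<mu> m by (intro mult_left_mono) auto
  finally show ?case by (simp add: mult_ac)
qed

lemma transfer_power_ge:
  assumes c: "admissible t c" "c 0 > 0" and \<mu>: "0 < \<mu>" and M: "0 < M"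
    and F: "\<And>x. x \<in> {0..1} \<Longrightarrow> F x \<le> M" "bounded (F ` {0..1})"
    and super: "\<And>x. x \<in> {0..1} \<Longrightarrow> \<mu> * F x \<le> transfer t c F x"
    and x: "x \<in> {0..1}"
  shows "\<mu> ^ n / M * F x \<le> (transfer t c ^^ n) (\<lambda>_. 1) x"
  using x
proof (induction n arbitrary: x)
  case 0
  then show ?case using F(1) M by simp
next
  case (Suc n)
  have "\<mu> ^ Suc n / M * F x = \<mu> ^ n / M * (\<mu> * F x)" by simp
  also have "\<dots> \<le> transfer t c (\<lambda>y. \<mu> ^ n / M * F y) x"
    unfolding transfer_cmult using super[OF Suc.prems] \<mu> M by (intro mult_left_mono) auto
  also have "\<dots> \<le> (transfer t c ^^ Suc n) (\<lambda>_. 1) x"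
    unfolding funpow.simps comp_def
    by (rule transfer_mono[OF c(1) bounded_image_cmult[OF F(2)] loglip_bounded[OF transfer_power_loglip[OF c]] Suc.prems Suc.IH])
  finally show ?case .
qed

lemma ln_partition_sum_le:
  assumes tq: "2 * t - q > 1" and \<mu>: "0 < \<mu>" and m: "0 < m"
    and F: "\<And>x. x \<in> {0..1} \<Longrightarrow> m \<le> F x" "bounded (F ` {0..1})"
    and sub: "\<And>x. x \<in> {0..1} \<Longrightarrow> transfer t (digit_powr q) F x \<le> \<mu> * F x"
  obtains B where "\<And>n. ln (partition_sum t q n) \<le> real n * ln \<mu> + B"
proof
  fix n
  note adm = digit_powr_admissible[OF tq]
  have F0: "0 < F 0" using F(1)[of 0] m by simp
  have f0: "0 < (transfer t (digit_powr q) ^^ n) (\<lambda>_. 1) 0"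
    using transfer_power_loglip[OF adm digit_powr_pos, of n] by (simp add: loglip_def)
  have "partition_sum t q n \<le> exp (4 * \<bar>t\<bar> * ln 2) * (\<mu> ^ n / m * F 0)"
    using partition_sum_bounds(2)[OF tq, of n] transfer_power_le[OF adm digit_powr_pos \<mu> m F sub, of 0 n]
    by (meson atLeastAtMost_iff exp_ge_zero mult_left_mono order.refl order_trans zero_le_one)
  moreover have "0 < partition_sum t q n"
    using partition_sum_bounds(1)[OF tq, of n] f0 by simp
  ultimately have "ln (partition_sum t q n) \<le> ln (exp (4 * \<bar>t\<bar> * ln 2) * (\<mu> ^ n / m * F 0))"
    by simp
  also have "\<dots> = real n * ln \<mu> + (4 * \<bar>t\<bar> * ln 2 - ln m + ln (F 0))"
    using \<mu> m F0 by (simp add: ln_mult ln_div ln_realpow)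
  finally show "ln (partition_sum t q n) \<le> real n * ln \<mu> + (4 * \<bar>t\<bar> * ln 2 - ln m + ln (F 0))" .
qed

lemma ln_partition_sum_ge:
  assumes tq: "2 * t - q > 1" and \<mu>: "0 < \<mu>" and F0: "0 < F 0"
    and F: "\<And>x. x \<in> {0..1} \<Longrightarrow> F x \<le> M" "bounded (F ` {0..1})"
    and super: "\<And>x. x \<in> {0..1} \<Longrightarrow> \<mu> * F x \<le> transfer t (digit_powr q) F x"
  obtains B where "\<And>n. real n * ln \<mu> + B \<le> ln (partition_sum t q n)"
proof
  fix n
  note adm = digit_powr_admissible[OF tq]
  have M: "0 < M" using F(1)[of 0] F0 by simp
  have pos: "0 < \<mu> ^ n / M * F 0" using \<mu> M F0 by simp
  have "\<mu> ^ n / M * F 0 \<le> partition_sum t q n"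
    using partition_sum_bounds(1)[OF tq, of n] transfer_power_ge[OF adm digit_powr_pos \<mu> M F super, of 0 n]
    by simp
  then have "ln (\<mu> ^ n / M * F 0) \<le> ln (partition_sum t q n)"
    using pos by (subst ln_le_cancel_iff) auto
  then show "real n * ln \<mu> + (ln (F 0) - ln M) \<le> ln (partition_sum t q n)"
    using \<mu> M F0 by (simp add: ln_mult ln_div ln_realpow)
qed

lemma tendsto_affine_div: "(\<lambda>n. 1 / real n * (real n * a + B)) \<longlonglongrightarrow> a"
proof (rule Lim_transform_eventually)
  show "(\<lambda>n. a + B / real n) \<longlonglongrightarrow> a"
    using tendsto_add[OF tendsto_const lim_const_over_n, of a B] by simp
  show "\<forall>\<^sub>F n in sequentially. a + B / real n = 1 / real n * (real n * a + B)"
    using eventually_gt_at_top[of 0] by eventually_elim (simp add: field_simps)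
qed

lemma pressure_eigenfunction:
  assumes tq: "2 * t - q > 1"
  shows "(\<lambda>n. 1 / real n * ln (partition_sum t q n)) \<longlonglongrightarrow> pressure t q"
    and "\<exists>h. loglip (4 * \<bar>t\<bar>) h \<and>
      (\<forall>x\<in>{0..1}. transfer t (digit_powr q) h x = exp (pressure t q) * h x)"
proof -
  note adm = digit_powr_admissible[OF tq]
  obtain r h where r: "0 < r" and h: "loglip (4 * \<bar>t\<bar>) h"
    and eig: "\<And>x. x \<in> {0..1} \<Longrightarrow> transfer t (digit_powr q) h x = r * h x"
    using transfer_eigenfunction[OF adm digit_powr_pos] by metis
  obtain m M where m: "0 < m" "\<And>x. x \<in> {0..1} \<Longrightarrow> m \<le> h x" and M: "\<And>x. x \<in> {0..1} \<Longrightarrow> h x \<le> M"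
    using loglip_bounds[OF h] by metis
  have h0: "0 < h 0" using h by (simp add: loglip_def)
  obtain B where B: "\<And>n. ln (partition_sum t q n) \<le> real n * ln r + B"
    using ln_partition_sum_le[OF tq r m loglip_bounded[OF h]] eig by (metis order_refl)
  obtain C where C: "\<And>n. real n * ln r + C \<le> ln (partition_sum t q n)"
    using ln_partition_sum_ge[of t q r h, OF tq r h0 M loglip_bounded[OF h]] eig by (metis order_refl)
  have lim: "(\<lambda>n. 1 / real n * ln (partition_sum t q n)) \<longlonglongrightarrow> ln r"
  proof (rule tendsto_sandwich[OF _ _ tendsto_affine_div[of "ln r" C] tendsto_affine_div[of "ln r" B]])
    show "\<forall>\<^sub>F n in sequentially. 1 / real n * (real n * ln r + C) \<le> 1 / real n * ln (partition_sum t q n)"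
      using C by (intro always_eventually allI mult_left_mono) auto
    show "\<forall>\<^sub>F n in sequentially. 1 / real n * ln (partition_sum t q n) \<le> 1 / real n * (real n * ln r + B)"
      using B by (intro always_eventually allI mult_left_mono) auto
  qed
  then have P: "pressure t q = ln r"
    unfolding pressure_def by (rule limI)
  with lim show "(\<lambda>n. 1 / real n * ln (partition_sum t q n)) \<longlonglongrightarrow> pressure t q" by simp
  show "\<exists>h. loglip (4 * \<bar>t\<bar>) h \<and>
      (\<forall>x\<in>{0..1}. transfer t (digit_powr q) h x = exp (pressure t q) * h x)"
    using P h eig r by auto
qed

lemma pressure_le:
  assumes tq: "2 * t - q > 1" and \<mu>: "0 < \<mu>" and m: "0 < m"
    and F: "\<And>x. x \<in> {0..1} \<Longrightarrow> m \<le> F x" "bounded (F ` {0..1})"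
    and sub: "\<And>x. x \<in> {0..1} \<Longrightarrow> transfer t (digit_powr q) F x \<le> \<mu> * F x"
  shows "pressure t q \<le> ln \<mu>"
proof -
  obtain B where B: "\<And>n. ln (partition_sum t q n) \<le> real n * ln \<mu> + B"
    using ln_partition_sum_le[OF assms] by blast
  show ?thesis
    by (rule LIMSEQ_le[OF pressure_eigenfunction(1)[OF tq] tendsto_affine_div[of "ln \<mu>" B]])
      (use B in \<open>auto intro!: divide_right_mono\<close>)
qed

lemma pressure_ge:
  assumes tq: "2 * t - q > 1" and \<mu>: "0 < \<mu>" and F0: "0 < F 0"
    and F: "\<And>x. x \<in> {0..1} \<Longrightarrow> F x \<le> M" "bounded (F ` {0..1})"
    and super: "\<And>x. x \<in> {0..1} \<Longrightarrow> \<mu> * F x \<le> transfer t (digit_powr q) F x"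
  shows "ln \<mu> \<le> pressure t q"
proof -
  obtain B where B: "\<And>n. real n * ln \<mu> + B \<le> ln (partition_sum t q n)"
    using ln_partition_sum_ge[of t q \<mu> F, OF assms] by blast
  show ?thesis
    by (rule LIMSEQ_le[OF tendsto_affine_div[of "ln \<mu>" B] pressure_eigenfunction(1)[OF tq]])
      (use B in \<open>auto intro!: divide_right_mono\<close>)
qed

lemma zeta_ge_1:
  assumes "s > 1" shows "1 \<le> zeta s"
proof -
  have "(\<Sum>n\<in>{0}. digit_powr (- s) n) \<le> zeta s"
    unfolding infsumI[OF zeta_has_sum[OF assms], symmetric]
    by (rule finite_sum_le_infsum[OF has_sum_imp_summable[OF zeta_has_sum[OF assms]]])
      (auto simp: digit_powr_def)
  then show ?thesis by (simp add: digit_powr_def)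
qed

lemma pressure_bounds:
  assumes tq: "2 * t - q > 1"
  shows "min 0 (- t) * ln 4 + ln (zeta (2 * t - q)) \<le> pressure t q"
    and "pressure t q \<le> max 0 (- t) * ln 4 + ln (zeta (2 * t - q))"
proof -
  note adm = digit_powr_admissible[OF tq]
  have z: "0 < zeta (2 * t - q)" using zeta_ge_1[OF tq] by simp
  have b1: "bounded ((\<lambda>_. 1 :: real) ` {0..1 :: real})"
    by (rule bounded_imageI[of _ _ 1]) simp
  have zs: "((\<lambda>n. digit_powr q n * real (Suc n) powr (- 2 * t)) has_sum zeta (2 * t - q)) UNIV"
  proof -
    have "digit_powr q n * real (Suc n) powr (- 2 * t) = digit_powr (- (2 * t - q)) n" for n
      by (simp add: digit_powr_def flip: powr_add)
    then show ?thesis using zeta_has_sum[OF tq] by simp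
  qed
  have le: "transfer t (digit_powr q) (\<lambda>_. 1) x \<le> 4 powr max 0 (- t) * zeta (2 * t - q)"
    if x: "x \<in> {0..1}" for x
    using transfer_has_sum[OF adm b1 x] has_sum_cmult_right[OF zs, of "4 powr max 0 (- t)"]
    by (rule has_sum_mono)
      (use mult_left_mono[OF branch_powr_bounds(1)[OF x, where t = t] less_imp_le[OF digit_powr_pos]] in
        \<open>auto simp: mult_ac\<close>)
  have ge: "4 powr min 0 (- t) * zeta (2 * t - q) \<le> transfer t (digit_powr q) (\<lambda>_. 1) x"
    if x: "x \<in> {0..1}" for x
    using has_sum_cmult_right[OF zs, of "4 powr min 0 (- t)"] transfer_has_sum[OF adm b1 x]
    by (rule has_sum_mono)
      (use mult_left_mono[OF branch_powr_bounds(2)[OF x, where t = t] less_imp_le[OF digit_powr_pos]] in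
        \<open>auto simp: mult_ac\<close>)
  have "pressure t q \<le> ln (4 powr max 0 (- t) * zeta (2 * t - q))"
    by (rule pressure_le[OF tq _ zero_less_one _ b1]) (use le z in auto)
  then show "pressure t q \<le> max 0 (- t) * ln 4 + ln (zeta (2 * t - q))"
    using z by (simp add: ln_mult ln_powr)
  have "ln (4 powr min 0 (- t) * zeta (2 * t - q)) \<le> pressure t q"
    by (rule pressure_ge[where F = "\<lambda>_. 1", OF tq _ _ order_refl b1]) (use ge z in auto)
  then show "min 0 (- t) * ln 4 + ln (zeta (2 * t - q)) \<le> pressure t q"
    using z by (simp add: ln_mult ln_powr)
qed

section \<open>Differentiability of the pressure\<close>

definition digit_log_powr :: "real \<Rightarrow> nat \<Rightarrow> real" where
  "digit_log_powr q n = digit_powr q n * ln (real (Suc n))"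

lemma digit_log_powr_admissible:
  assumes tq: "2 * t - q > 1"
  shows "admissible t (digit_log_powr q)"
proof -
  define d where "d = (2 * t - q - 1) / 2"
  have d: "0 < d" "2 * t - (q + d) > 1" using tq by (auto simp: d_def field_simps)
  have sum: "(\<lambda>n. 1 / d * (digit_powr (q + d) n * real (Suc n) powr (- 2 * t))) summable_on UNIV"
    using digit_powr_admissible[OF d(2)] by (intro summable_on_cmult_right) (simp add: admissible_def)
  have le: "digit_log_powr q n * real (Suc n) powr (- 2 * t)
      \<le> 1 / d * (digit_powr (q + d) n * real (Suc n) powr (- 2 * t))" for n
  proof -
    have "ln (real (Suc n)) \<le> real (Suc n) powr d / d" by (rule ln_powr_bound) (use d in auto)
    then have "digit_powr q n * ln (real (Suc n)) \<le> digit_powr q n * (real (Suc n) powr d / d)"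
      using digit_powr_pos[of q n] by (intro mult_left_mono) auto
    also have "\<dots> = 1 / d * digit_powr (q + d) n"
      unfolding digit_powr_add by (simp add: digit_powr_def)
    finally have "digit_powr q n * ln (real (Suc n)) \<le> 1 / d * digit_powr (q + d) n" .
    then have "digit_powr q n * ln (real (Suc n)) * real (Suc n) powr (- 2 * t)
        \<le> 1 / d * digit_powr (q + d) n * real (Suc n) powr (- 2 * t)"
      by (intro mult_right_mono) auto
    then show ?thesis by (simp only: digit_log_powr_def mult.assoc)
  qed
  have "0 \<le> digit_log_powr q n" for n
    using digit_powr_pos[of q n] by (simp add: digit_log_powr_def)
  then show ?thesis
    unfolding admissible_def using summable_on_comparison_test[OF sum le] by simp
qed

lemma exp_le_quadratic: "exp (y :: real) \<le> 1 + y + y\<^sup>2 * exp \<bar>y\<bar>"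
proof -
  obtain z where z: "\<bar>z\<bar> \<le> \<bar>y\<bar>" "exp y = (\<Sum>m<2. y ^ m / fact m) + exp z / fact 2 * y ^ 2"
    using Maclaurin_exp_le[of y 2] by auto
  have "exp z / fact 2 * y ^ 2 \<le> exp \<bar>y\<bar> * y ^ 2"
  proof (rule mult_right_mono)
    have "exp z \<le> exp \<bar>y\<bar>" using z(1) by simp
    moreover have "exp z / fact 2 \<le> exp z" by (simp add: fact_2)
    ultimately show "exp z / fact 2 \<le> exp \<bar>y\<bar>" by (rule order_trans[rotated])
  qed simp
  then show ?thesis using z(2) by (simp add: numeral_2_eq_2 mult_ac)
qed

lemma square_le_exp: 
  assumes "0 < d" shows "y\<^sup>2 \<le> 2 / d\<^sup>2 * exp (d * \<bar>y :: real\<bar>)"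
proof -
  have "(d * \<bar>y\<bar>)\<^sup>2 / 2 \<le> exp (d * \<bar>y\<bar>)"
    using exp_lower_Taylor_quadratic[of "d * \<bar>y\<bar>"] assms by (smt (verit) abs_ge_zero mult_nonneg_nonneg)
  then show ?thesis using assms by (simp add: field_simps power_mult_distrib)
qed

locale pressure_eigen =
  fixes t q :: real and h :: "real \<Rightarrow> real"
  assumes tq: "2 * t - q > 1"
    and h: "loglip (4 * \<bar>t\<bar>) h"
    and eig: "\<And>x. x \<in> {0..1} \<Longrightarrow> transfer t (digit_powr q) h x = exp (pressure t q) * h x"
begin

abbreviation "c \<equiv> digit_powr q"

lemma adm: "admissible t c"
  by (rule digit_powr_admissible[OF tq])

lemma h_pos: "x \<in> {0..1} \<Longrightarrow> 0 < h x"
  using h by (simp add: loglip_def)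

definition weight :: "real \<Rightarrow> nat \<Rightarrow> real" where
  "weight x n = c n * branch n x powr (2 * t) * h (branch n x) / (exp (pressure t q) * h x)"

lemma weight_nonneg: "x \<in> {0..1} \<Longrightarrow> 0 \<le> weight x n"
  unfolding weight_def using h_pos branch_mem digit_powr_pos[of q n] 
  by (intro divide_nonneg_nonneg mult_nonneg_nonneg) (auto intro: less_imp_le)

lemma weight_has_sum:
  assumes "x \<in> {0..1}" "bounded (f ` {0..1})" "admissible t (\<lambda>n. c n * a n)"
  shows "((\<lambda>n. weight x n * (a n * f (branch n x))) has_sum
    (transfer t (\<lambda>n. c n * a n) (\<lambda>y. h y * f y) x / (exp (pressure t q) * h x))) UNIV"
  using has_sum_cmult_left[OF transfer_has_sum[OF assms(3)
        bounded_image_mult[OF loglip_bounded[OF h] assms(2)] assms(1)], of "1 / (exp (pressure t q) * h x)"]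
  by (simp add: weight_def mult_ac)

lemma weight_sum_markov:
  assumes "x \<in> {0..1}" "bounded (f ` {0..1})"
  shows "((\<lambda>n. weight x n * f (branch n x)) has_sum markov t c h f x) UNIV"
  using weight_has_sum[OF assms, of "\<lambda>_. 1"] adm by (simp add: markov_def eig[OF assms(1)])

lemma weight_sum_1: "x \<in> {0..1} \<Longrightarrow> (weight x has_sum 1) UNIV"
  using weight_has_sum[of x "\<lambda>_. 1" "\<lambda>_. 1"] adm h_pos[of x] eig[of x]
  by (simp add: bounded_imageI[of _ _ 1])

fun mean_log :: "nat \<Rightarrow> real \<Rightarrow> real" where
  "mean_log 0 x = transfer t (digit_log_powr q) h x / (exp (pressure t q) * h x)"
| "mean_log (Suc n) x = markov t c h (mean_log n) x"

declare mean_log.simps [simp del]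

lemma mean_log_has_sum:
  assumes "x \<in> {0..1}"
  shows "((\<lambda>n. weight x n * ln (real (Suc n))) has_sum mean_log 0 x) UNIV"
  using weight_has_sum[OF assms, of "\<lambda>_. 1" "\<lambda>n. ln (real (Suc n))"] digit_log_powr_admissible[OF tq]
  by (simp add: bounded_imageI[of _ _ 1] digit_log_powr_def[abs_def] mean_log.simps(1))

lemma mean_log_0_nonneg: "x \<in> {0..1} \<Longrightarrow> 0 \<le> mean_log 0 x"
  by (rule has_sum_nonneg[OF mean_log_has_sum]) (auto intro!: mult_nonneg_nonneg weight_nonneg)

lemma mean_log_0_distortion:
  assumes xy: "x \<in> {0..1}" "y \<in> {0..1}"
  shows "mean_log 0 x \<le> exp (distort t * ldist x y) * mean_log 0 y"
proof -
  have T0: "0 \<le> transfer t (digit_log_powr q) h z" if "z \<in> {0..1}" for z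
    
  proof -
    have "0 < exp (pressure t q) * h z" using h_pos[OF that] by simp
    then show ?thesis using mean_log_0_nonneg[OF that]
      unfolding mean_log.simps zero_le_divide_iff by linarith
  qed
  have "transfer t (digit_log_powr q) h x * h y \<le>
      (exp (4 * \<bar>t\<bar> * ldist x y) * transfer t (digit_log_powr q) h y) * (exp (4 * \<bar>t\<bar> * ldist x y) * h x)"
  proof (rule mult_mono)
    show "transfer t (digit_log_powr q) h x \<le> exp (4 * \<bar>t\<bar> * ldist x y) * transfer t (digit_log_powr q) h y"
      using transfer_distortion[OF digit_log_powr_admissible[OF tq] h xy] by simp
    show "h y \<le> exp (4 * \<bar>t\<bar> * ldist x y) * h x"
      using h xy ldist_commute[of x y] by (auto simp: loglip_def)
  qed (use T0[OF xy(2)] h_pos[OF xy(2)] in auto)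
  also have "\<dots> = exp (8 * \<bar>t\<bar> * ldist x y) * (transfer t (digit_log_powr q) h y * h x)"
    by (simp add: mult_exp_exp mult.assoc mult.left_commute mult.commute[of "h x"])
  also have "\<dots> \<le> exp (distort t * ldist x y) * (transfer t (digit_log_powr q) h y * h x)"
    using T0[OF xy(2)] h_pos[OF xy(1)] ldist_nonneg[of x y]
    by (intro mult_right_mono) (auto simp: distort_def mult_right_mono)
  finally show ?thesis
    using h_pos[OF xy(1)] h_pos[OF xy(2)] by (simp add: mean_log.simps(1) field_simps)
qed

lemma mean_log_converges:
  obtains A D where "0 \<le> A" "\<And>n x. x \<in> {0..1} \<Longrightarrow> \<bar>mean_log n x - D\<bar> \<le> A * rate t ^ n"
proof -
  define A where "A = exp (distort t * ln 2) * mean_log 0 0"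
  have A0: "0 \<le> A" using mean_log_0_nonneg[of 0] by (simp add: A_def)
  have "contr t A (mean_log 0)"
  proof (rule contr_of_distortion)
    fix x :: real assume x: "x \<in> {0..1}"
    have "mean_log 0 x \<le> exp (distort t * ldist x 0) * mean_log 0 0"
      by (rule mean_log_0_distortion) (use x in auto)
    also have "\<dots> \<le> A"
      unfolding A_def using mean_log_0_nonneg[of 0] ldist_le[OF x, of 0] distort_pos[of t]
      by (intro mult_right_mono) auto
    finally show "mean_log 0 x \<le> A" .
  qed (auto intro: mean_log_0_distortion mean_log_0_nonneg)
  then obtain D where "\<And>n x. x \<in> {0..1} \<Longrightarrow> \<bar>mean_log n x - D\<bar> \<le> A * rate t ^ n"
    using markov_iterates_converge[where v = "\<lambda>_. h" and g = mean_log, OF adm digit_powr_pos h _ A0]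
      mean_log.simps(2) by blast
  with A0 show ?thesis by (rule that)
qed

lemma mean_log_nonneg: "x \<in> {0..1} \<Longrightarrow> 0 \<le> mean_log n x"
  and mean_log_bounded: "bounded (mean_log n ` {0..1})"
proof -
  obtain A D where A: "0 \<le> A" and AD: "\<And>n x. x \<in> {0..1} \<Longrightarrow> \<bar>mean_log n x - D\<bar> \<le> A * rate t ^ n"
    using mean_log_converges by blast
  have bd: "mean_log n x \<le> A + \<bar>D\<bar>" "\<bar>mean_log n x\<bar> \<le> A + \<bar>D\<bar>" if "x \<in> {0..1}" for n x
  proof -
    have "A * rate t ^ n \<le> A * 1"
      using A rate_bounds[of t] by (intro mult_left_mono power_le_one) auto
    then show "mean_log n x \<le> A + \<bar>D\<bar>" "\<bar>mean_log n x\<bar> \<le> A + \<bar>D\<bar>"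
      using AD[OF that, of n] by auto
  qed
  then show "bounded (mean_log n ` {0..1})" by (intro bounded_imageI)
  show "0 \<le> mean_log n x" if "x \<in> {0..1}"
    using that
  proof (induction n arbitrary: x)
    case (Suc n)
    show ?case
      unfolding mean_log.simps
      by (rule markov_bounds(1)[OF adm digit_powr_pos h Suc.IH bd(1) Suc.prems])
  qed (rule mean_log_0_nonneg)
qed

text \<open>With \<open>G = potential N\<close>, the function \<open>h e\<^sup>s\<^sup>G\<close> is an eigenfunction at \<open>q + s\<close> up to
  first order in \<open>s\<close>, because \<open>mean_log 0 + markov G - G = mean_log N\<close> is almost constant.\<close>

definition potential :: "nat \<Rightarrow> real \<Rightarrow> real" where
  "potential N x = (\<Sum>k<N. mean_log k x)"

lemma potential_bounded: "bounded (potential N ` {0..1})"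
proof -
  have "\<exists>B. \<forall>x\<in>{0..1}. \<bar>mean_log k x\<bar> \<le> B" for k
    using bounded_imageD[OF mean_log_bounded[of k]] by metis
  then obtain B where "\<And>k x. x \<in> {0..1} \<Longrightarrow> \<bar>mean_log k x\<bar> \<le> B k" by metis
  then show ?thesis
    unfolding potential_def
    by (intro bounded_imageI[where B = "sum B {..<N}"] order_trans[OF sum_abs] sum_mono)
qed

lemma potential_cohomology:
  assumes x: "x \<in> {0..1}"
  shows "mean_log 0 x + markov t c h (potential N) x - potential N x = mean_log N x"
proof (induction N)
  case 0
  show ?case by (simp add: potential_def markov_def transfer_def)
next
  case (Suc N)
  have "markov t c h (potential (Suc N)) x = markov t c h (potential N) x + markov t c h (mean_log N) x"
    using has_sum_unique[OF weight_sum_markov[OF x potential_bounded[of "Suc N"]]]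
      has_sum_add[OF weight_sum_markov[OF x potential_bounded[of N]] weight_sum_markov[OF x mean_log_bounded[of N]]]
    by (simp add: potential_def distrib_left)
  moreover have "potential (Suc N) x = potential N x + mean_log N x"
    by (simp add: potential_def)
  ultimately show ?case using Suc.IH by (simp add: mean_log.simps(2))
qed

definition displacement :: "nat \<Rightarrow> real \<Rightarrow> nat \<Rightarrow> real" where
  "displacement N x n = ln (real (Suc n)) + potential N (branch n x) - potential N x"

lemma displacement_has_sum:
  assumes x: "x \<in> {0..1}"
  shows "((\<lambda>n. weight x n * displacement N x n) has_sum mean_log N x) UNIV"
proof -
  have "((\<lambda>n. weight x n * ln (real (Suc n)) + weight x n * potential N (branch n x) + weight x n * (- potential N x))
     has_sum (mean_log 0 x + markov t c h (potential N) x + 1 * (- potential N x))) UNIV"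
    by (intro has_sum_add mean_log_has_sum weight_sum_markov potential_bounded x
        has_sum_cmult_left weight_sum_1)
  moreover have "mean_log 0 x + markov t c h (potential N) x + 1 * (- potential N x) = mean_log N x"
    using potential_cohomology[OF x, of N] by simp
  ultimately show ?thesis
    by (simp add: displacement_def algebra_simps)
qed

definition trial :: "nat \<Rightarrow> real \<Rightarrow> real \<Rightarrow> real" where
  "trial N s x = h x * exp (s * potential N x)"

lemma trial_bounds:
  obtains m M where "0 < m" "\<And>x. x \<in> {0..1} \<Longrightarrow> m \<le> trial N s x" "\<And>x. x \<in> {0..1} \<Longrightarrow> trial N s x \<le> M"
proof -
  obtain m M where m: "0 < m" "\<And>x. x \<in> {0..1} \<Longrightarrow> m \<le> h x" and M: "\<And>x. x \<in> {0..1} \<Longrightarrow> h x \<le> M"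
    using loglip_bounds[OF h] by metis
  obtain B where B: "\<And>x. x \<in> {0..1} \<Longrightarrow> \<bar>potential N x\<bar> \<le> B"
    using potential_bounded bounded_imageD by metis
  have sB: "\<bar>s * potential N x\<bar> \<le> \<bar>s\<bar> * B" if "x \<in> {0..1}" for x
    using B[OF that] by (simp add: abs_mult mult_left_mono)
  show ?thesis
  proof (rule that)
    show "0 < m * exp (- (\<bar>s\<bar> * B))" using m by simp
    fix x :: real assume x: "x \<in> {0..1}"
    show "m * exp (- (\<bar>s\<bar> * B)) \<le> trial N s x"
      unfolding trial_def using m x sB[OF x] h_pos[OF x] by (intro mult_mono) auto
    show "trial N s x \<le> M * exp (\<bar>s\<bar> * B)"
      unfolding trial_def using M[OF x] x sB[OF x] h_pos[OF x] by (intro mult_mono) auto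
  qed
qed

lemma trial_bounded: "bounded (trial N s ` {0..1})"
  using trial_bounds[of N s] by (metis abs_of_pos bounded_imageI less_le_trans)

lemma trial_has_sum:
  assumes x: "x \<in> {0..1}" and s: "2 * t - (q + s) > 1"
  shows "((\<lambda>n. weight x n * exp (s * displacement N x n)) has_sum
    (transfer t (digit_powr (q + s)) (trial N s) x / (exp (pressure t q) * trial N s x))) UNIV"
proof -
  have adm': "admissible t (digit_powr (q + s))" by (rule digit_powr_admissible[OF s])
  have "weight x n * exp (s * displacement N x n) =
      digit_powr (q + s) n * branch n x powr (2 * t) * trial N s (branch n x) * (1 / (exp (pressure t q) * trial N s x))" for n
  proof -
    have "exp (s * ln (real (Suc n))) = digit_powr s n"
      by (simp add: digit_powr_def powr_def)
    then have "exp (s * displacement N x n) = digit_powr s n * exp (s * potential N (branch n x)) / exp (s * potential N x)"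
      by (simp add: displacement_def distrib_left right_diff_distrib exp_add exp_diff del: of_nat_Suc)
    then show ?thesis
      by (simp add: weight_def trial_def digit_powr_add mult_ac)
  qed
  then show ?thesis
    using has_sum_cmult_left[OF transfer_has_sum[OF adm' trial_bounded[of N s] x], of "1 / (exp (pressure t q) * trial N s x)"]
    by simp
qed

lemma trial_pos: "x \<in> {0..1} \<Longrightarrow> 0 < trial N s x"
  by (simp add: trial_def h_pos)

lemma trial_transfer_ge:
  assumes x: "x \<in> {0..1}" and s: "2 * t - (q + s) > 1"
  shows "exp (pressure t q + s * mean_log N x) * trial N s x \<le> transfer t (digit_powr (q + s)) (trial N s) x"
proof -
  define m where "m = s * mean_log N x"
  have "exp m * (1 - m) * 1 + exp m * s * mean_log N x \<le>
      transfer t (digit_powr (q + s)) (trial N s) x / (exp (pressure t q) * trial N s x)"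
  proof (rule has_sum_mono[OF _ trial_has_sum[OF x s]])
    show "((\<lambda>n. exp m * (1 - m) * weight x n + exp m * s * (weight x n * displacement N x n)) has_sum
        (exp m * (1 - m) * 1 + exp m * s * mean_log N x)) UNIV"
      by (intro has_sum_add has_sum_cmult_right weight_sum_1 displacement_has_sum x)
    fix n
    have "exp m * (1 + (s * displacement N x n - m)) \<le> exp m * exp (s * displacement N x n - m)"
      by (intro mult_left_mono exp_ge_add_one_self) auto
    also have "\<dots> = exp (s * displacement N x n)" by (simp flip: exp_add)
    finally have "weight x n * (exp m * (1 + (s * displacement N x n - m))) \<le> weight x n * exp (s * displacement N x n)"
      by (intro mult_left_mono weight_nonneg x)
    then show "exp m * (1 - m) * weight x n + exp m * s * (weight x n * displacement N x n) \<le> weight x n * exp (s * displacement N x n)"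
      by (simp add: algebra_simps)
  qed
  also have "exp m * (1 - m) * 1 + exp m * s * mean_log N x = exp m"
    by (simp add: m_def algebra_simps)
  finally show ?thesis
    using trial_pos[OF x, of N s] by (simp add: m_def exp_add field_simps)
qed

lemma trial_transfer_le:
  obtains d K where "0 < d" "0 \<le> K"
    "\<And>s x. \<bar>s\<bar> \<le> d \<Longrightarrow> 2 * t - (q + s) > 1 \<and> (x \<in> {0..1} \<longrightarrow>
       transfer t (digit_powr (q + s)) (trial N s) x \<le> exp (pressure t q + s * mean_log N x + s\<^sup>2 * K) * trial N s x)"
proof -
  define d where "d = (2 * t - q - 1) / 4"
  have d: "0 < d" "2 * t - (q + 2 * d) > 1" using tq by (auto simp: d_def field_simps)
  obtain B where B: "\<And>x. x \<in> {0..1} \<Longrightarrow> \<bar>potential N x\<bar> \<le> B" "0 \<le> B"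
    using potential_bounded bounded_imageD by metis
  define K1 where "K1 = 2 / d\<^sup>2 * exp (4 * d * B)"
  have adm2: "admissible t (digit_powr (q + 2 * d))" by (rule digit_powr_admissible[OF d(2)])
  obtain m where m: "0 < m" "\<And>x. x \<in> {0..1} \<Longrightarrow> m \<le> h x"
    using loglip_bounds[OF h] by metis
  obtain M where M: "\<And>x. x \<in> {0..1} \<Longrightarrow> transfer t (digit_powr (q + 2 * d)) h x \<le> M"
    using loglip_bounds[OF transfer_loglip[OF adm2 digit_powr_pos h]] by metis
  have M0: "0 \<le> M"
    using M[of 0] transfer_pos[OF adm2 digit_powr_pos h, of 0] by simp
  define K2 where "K2 = M / (exp (pressure t q) * m)"
  have K: "0 \<le> K1 * K2" using m M0 by (simp add: K1_def K2_def)
  show ?thesis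
  proof (rule that[OF d(1) K], intro conjI impI)
    fix s x :: real
    assume s: "\<bar>s\<bar> \<le> d"
    show s2: "2 * t - (q + s) > 1" using s d by simp
    assume x: "x \<in> {0..1}"
    have quad: "exp (s * displacement N x n) \<le> 1 + s * displacement N x n + s\<^sup>2 * K1 * digit_powr (2 * d) n" for n
    proof -
      define y where "y = displacement N x n"
      have "\<bar>y\<bar> \<le> ln (real (Suc n)) + 2 * B"
      proof -
        have "0 \<le> ln (real (Suc n))" by simp
        then show ?thesis using B(1)[OF x] B(1)[OF branch_mem[OF x, of n]]
          unfolding y_def displacement_def by linarith
      qed
      then have "2 * d * \<bar>y\<bar> \<le> 2 * d * (ln (real (Suc n)) + 2 * B)"
        using d by (intro mult_left_mono) auto
      then have "exp (2 * d * \<bar>y\<bar>) \<le> exp (2 * d * (ln (real (Suc n)) + 2 * B))" by simp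
      also have "\<dots> = exp (4 * d * B) * digit_powr (2 * d) n"
        by (simp add: digit_powr_def powr_def distrib_left exp_add mult_ac del: of_nat_Suc)
      finally have e: "exp (2 * d * \<bar>y\<bar>) \<le> exp (4 * d * B) * digit_powr (2 * d) n" .
      have "y\<^sup>2 * exp \<bar>s * y\<bar> \<le> (2 / d\<^sup>2 * exp (d * \<bar>y\<bar>)) * exp (d * \<bar>y\<bar>)"
        using s by (intro mult_mono square_le_exp d) (auto simp: abs_mult mult_right_mono)
      also have "\<dots> = 2 / d\<^sup>2 * exp (2 * d * \<bar>y\<bar>)" by (simp flip: exp_add)
      also have "\<dots> \<le> 2 / d\<^sup>2 * (exp (4 * d * B) * digit_powr (2 * d) n)"
        using e by (intro mult_left_mono) auto
      also have "\<dots> = K1 * digit_powr (2 * d) n" by (simp add: K1_def)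
      finally have "s\<^sup>2 * (y\<^sup>2 * exp \<bar>s * y\<bar>) \<le> s\<^sup>2 * (K1 * digit_powr (2 * d) n)"
        by (intro mult_left_mono) auto
      then show ?thesis
        using exp_le_quadratic[of "s * y"] unfolding y_def by (simp add: power_mult_distrib mult_ac)
    qed
    have powr_sum: "((\<lambda>n. weight x n * digit_powr (2 * d) n) has_sum
        (transfer t (digit_powr (q + 2 * d)) h x / (exp (pressure t q) * h x))) UNIV"
      using weight_has_sum[OF x, of "\<lambda>_. 1" "digit_powr (2 * d)"] adm2
      by (simp add: bounded_imageI[of _ _ 1] digit_powr_add[abs_def])
    have le2: "transfer t (digit_powr (q + 2 * d)) h x / (exp (pressure t q) * h x) \<le> K2"
      unfolding K2_def using M[OF x] M0 m x by (intro frac_le) auto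
    have "transfer t (digit_powr (q + s)) (trial N s) x / (exp (pressure t q) * trial N s x) \<le>
        1 + s * mean_log N x + s\<^sup>2 * K1 * (transfer t (digit_powr (q + 2 * d)) h x / (exp (pressure t q) * h x))"
    proof (rule has_sum_mono[OF trial_has_sum[OF x s2]])
      show "((\<lambda>n. weight x n + s * (weight x n * displacement N x n) + s\<^sup>2 * K1 * (weight x n * digit_powr (2 * d) n)) has_sum
          (1 + s * mean_log N x + s\<^sup>2 * K1 * (transfer t (digit_powr (q + 2 * d)) h x / (exp (pressure t q) * h x)))) UNIV"
        by (intro has_sum_add has_sum_cmult_right weight_sum_1 displacement_has_sum powr_sum x)
      fix n
      show "weight x n * exp (s * displacement N x n) \<le>
          weight x n + s * (weight x n * displacement N x n) + s\<^sup>2 * K1 * (weight x n * digit_powr (2 * d) n)"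
        using mult_left_mono[OF quad weight_nonneg[OF x]] by (simp add: algebra_simps)
    qed
    also have "\<dots> \<le> 1 + s * mean_log N x + s\<^sup>2 * K1 * K2"
      using le2 by (intro add_left_mono mult_left_mono) (auto simp: K1_def)
    also have "\<dots> \<le> exp (s * mean_log N x + s\<^sup>2 * (K1 * K2))"
      using exp_ge_add_one_self[of "s * mean_log N x + s\<^sup>2 * (K1 * K2)"] by (simp add: add.assoc mult.assoc)
    finally show "transfer t (digit_powr (q + s)) (trial N s) x
        \<le> exp (pressure t q + s * mean_log N x + s\<^sup>2 * (K1 * K2)) * trial N s x"
      using trial_pos[OF x, of N s] by (simp add: exp_add field_simps)
  qed
qed

end

lemma pressure_differentiable:
  assumes tq: "2 * t - q > 1"
  obtains D where "0 \<le> D" "((\<lambda>r. pressure t r) has_real_derivative D) (at q)"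
    "\<And>r. 2 * t - r > 1 \<Longrightarrow> pressure t q + (r - q) * D \<le> pressure t r"
proof -
  obtain h where "pressure_eigen t q h"
    using pressure_eigenfunction(2)[OF tq] tq unfolding pressure_eigen_def by blast
  then interpret pressure_eigen t q h .
  obtain A D where A: "0 \<le> A" and AD: "\<And>n x. x \<in> {0..1} \<Longrightarrow> \<bar>mean_log n x - D\<bar> \<le> A * rate t ^ n"
    using mean_log_converges by blast
  have tend: "(\<lambda>n. A * rate t ^ n) \<longlonglongrightarrow> 0"
    using tendsto_mult_right[OF LIMSEQ_realpow_zero[of "rate t"], of A] rate_bounds[of t]
    by (simp add: mult.commute)
  have err: "\<bar>s * mean_log N x - s * D\<bar> \<le> \<bar>s\<bar> * (A * rate t ^ N)" if "x \<in> {0..1}" for s N x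
    using mult_left_mono[OF AD[OF that, of N], of "\<bar>s\<bar>"] by (simp add: abs_mult flip: right_diff_distrib)
  have D0: "0 \<le> D"
  proof (rule LIMSEQ_le_const2[OF _ exI[of _ 0]])
    show "(\<lambda>n. - (A * rate t ^ n)) \<longlonglongrightarrow> 0" using tendsto_minus[OF tend] by simp
  next
    show "\<forall>n\<ge>0. - (A * rate t ^ n) \<le> D"
      using AD[of 0] mean_log_nonneg[of 0] by (smt (verit) atLeastAtMost_iff zero_le_one)
  qed
  have lower: "pressure t q + s * D \<le> pressure t (q + s)" if s: "2 * t - (q + s) > 1" for s
  proof (rule LIMSEQ_le_const2[OF _ exI[of _ 0]])
    show "(\<lambda>N. pressure t q + s * D - \<bar>s\<bar> * (A * rate t ^ N)) \<longlonglongrightarrow> pressure t q + s * D"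
      using tendsto_diff[OF tendsto_const tendsto_mult_left[OF tend], of "pressure t q + s * D" "\<bar>s\<bar>"] by simp
    show "\<forall>N\<ge>0. pressure t q + s * D - \<bar>s\<bar> * (A * rate t ^ N) \<le> pressure t (q + s)"
    proof (intro allI impI)
      fix N :: nat
      let ?e = "pressure t q + s * D - \<bar>s\<bar> * (A * rate t ^ N)"
      obtain m M where M: "\<And>x. x \<in> {0..1} \<Longrightarrow> trial N s x \<le> M"
        using trial_bounds[of N s] by metis
      have "ln (exp ?e) \<le> pressure t (q + s)"
      proof (rule pressure_ge[where F = "trial N s" and M = M, OF s _ _ M trial_bounded])
        fix x :: real assume x: "x \<in> {0..1}"
        have "exp ?e * trial N s x \<le> exp (pressure t q + s * mean_log N x) * trial N s x"
          using err[OF x, of s N] trial_pos[OF x, of N s] by (intro mult_right_mono) auto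
        also note trial_transfer_ge[OF x s]
        finally show "exp ?e * trial N s x \<le> transfer t (digit_powr (q + s)) (trial N s) x" .
      qed (auto simp: trial_pos)
      then show "?e \<le> pressure t (q + s)" by simp
    qed
  qed
  have "((\<lambda>s. (pressure t (q + s) - pressure t q) / s) \<longlongrightarrow> D) (at 0)"
  proof (rule tendstoI)
    fix e :: real assume e: "0 < e"
    obtain N where N: "A * rate t ^ N < e / 2"
      using order_tendstoD(2)[OF tend, of "e / 2"] e by (auto simp: eventually_sequentially)
    obtain d K where d: "0 < d" and K: "0 \<le> K" and
      up: "\<And>s x. \<bar>s\<bar> \<le> d \<Longrightarrow> 2 * t - (q + s) > 1 \<and> (x \<in> {0..1} \<longrightarrow>
       transfer t (digit_powr (q + s)) (trial N s) x \<le> exp (pressure t q + s * mean_log N x + s\<^sup>2 * K) * trial N s x)"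
      using trial_transfer_le[of N] by metis
    have upper: "pressure t (q + s) \<le> pressure t q + s * D + \<bar>s\<bar> * (A * rate t ^ N) + s\<^sup>2 * K" if s: "\<bar>s\<bar> \<le> d" for s
    proof -
      let ?e = "pressure t q + s * D + \<bar>s\<bar> * (A * rate t ^ N) + s\<^sup>2 * K"
      have dom: "2 * t - (q + s) > 1" using up[OF s] by blast
      obtain m where m: "0 < m" "\<And>x. x \<in> {0..1} \<Longrightarrow> m \<le> trial N s x"
        using trial_bounds[of N s] by metis
      have "pressure t (q + s) \<le> ln (exp ?e)"
      proof (rule pressure_le[OF dom _ m trial_bounded])
        fix x :: real assume x: "x \<in> {0..1}"
        have "transfer t (digit_powr (q + s)) (trial N s) x
            \<le> exp (pressure t q + s * mean_log N x + s\<^sup>2 * K) * trial N s x"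
          using up[OF s] x by blast
        also have "\<dots> \<le> exp ?e * trial N s x"
          using err[OF x, of s N] trial_pos[OF x, of N s] by (intro mult_right_mono) auto
        finally show "transfer t (digit_powr (q + s)) (trial N s) x \<le> exp ?e * trial N s x" .
      qed simp
      then show ?thesis by simp
    qed
    have "dist ((pressure t (q + s) - pressure t q) / s) D < e"
      if s: "s \<noteq> 0" "\<bar>s\<bar> < min d (e / (2 * (K + 1)))" for s
    proof -
      have dom: "2 * t - (q + s) > 1" using up[of s] s by auto
      have "\<bar>pressure t (q + s) - pressure t q - s * D\<bar> \<le> \<bar>s\<bar> * (A * rate t ^ N + \<bar>s\<bar> * K)"
        using lower[OF dom] upper[of s] s by (simp add: algebra_simps power2_eq_square)
      moreover have "(pressure t (q + s) - pressure t q) / s - D = (pressure t (q + s) - pressure t q - s * D) / s"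
        using s by (simp add: diff_divide_distrib)
      ultimately have "dist ((pressure t (q + s) - pressure t q) / s) D \<le> A * rate t ^ N + \<bar>s\<bar> * K"
        using s by (simp add: dist_real_def abs_divide pos_divide_le_eq mult.commute)
      moreover have "\<bar>s\<bar> * K \<le> e / (2 * (K + 1)) * K"
        using s K by (intro mult_right_mono) auto
      moreover have "e / (2 * (K + 1)) * K \<le> e / 2" using e K by (simp add: field_simps)
      ultimately show ?thesis using N by linarith
    qed
    then show "\<forall>\<^sub>F s in at 0. dist ((pressure t (q + s) - pressure t q) / s) D < e"
      unfolding eventually_at using d e K
      by (intro exI[of _ "min d (e / (2 * (K + 1)))"]) auto
  qed
  then have "((\<lambda>r. pressure t r) has_real_derivative D) (at q)" by (simp add: DERIV_def)
  moreover have "pressure t q + (r - q) * D \<le> pressure t r" if "2 * t - r > 1" for r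
    using lower[of "r - q"] that by simp
  ultimately show ?thesis using D0 that by blast
qed

section \<open>Boundary behaviour\<close>

lemma zeta_antimono:
  assumes "1 < s" "s \<le> s'"
  shows "zeta s' \<le> zeta s"
proof (rule has_sum_mono[OF zeta_has_sum zeta_has_sum])
  fix n
  show "digit_powr (- s') n \<le> digit_powr (- s) n"
    unfolding digit_powr_def using assms by (intro powr_mono) auto
qed (use assms in auto)

lemma zeta_at_right_1: "filterlim zeta at_top (at_right 1)"
  unfolding filterlim_at_top
proof
  fix Z :: real
  obtain N where N: "Z < (\<Sum>n<N. 1 / real (Suc n))"
  proof (rule ccontr)
    assume "\<not> thesis"
    then have "(\<Sum>n<N. 1 / real (Suc n)) \<le> Z" for N using that by (meson not_le)
    then have "summable (\<lambda>n. 1 / real (Suc n))"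
      by (intro summableI_nonneg_bounded) auto
    then have "summable (\<lambda>n. 1 / real n)"
      using summable_Suc_iff[of "\<lambda>n. 1 / real n"] by simp
    then show False using not_summable_harmonic[where 'a = real] by (simp add: inverse_eq_divide)
  qed
  have "((\<lambda>s. \<Sum>n<N. real (Suc n) powr (- s)) \<longlongrightarrow> (\<Sum>n<N. real (Suc n) powr (- 1))) (at_right 1)"
    by (intro tendsto_intros) auto
  also have "(\<Sum>n<N. real (Suc n) powr (- 1)) = (\<Sum>n<N. 1 / real (Suc n))"
    by (intro sum.cong refl) (simp add: powr_minus_divide)
  finally have "\<forall>\<^sub>F s in at_right 1. Z < (\<Sum>n<N. real (Suc n) powr (- s))"
    using N by (rule order_tendstoD)
  moreover have "\<forall>\<^sub>F s in at_right (1 :: real). 1 < s" by (rule eventually_at_right_less)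
  ultimately show "\<forall>\<^sub>F s in at_right 1. Z \<le> zeta s"
  proof eventually_elim
    case (elim s)
    have "(\<Sum>n<N. digit_powr (- s) n) \<le> zeta s"
      unfolding infsumI[OF zeta_has_sum[OF elim(2)], symmetric]
      by (rule finite_sum_le_infsum[OF has_sum_imp_summable[OF zeta_has_sum[OF elim(2)]]])
        (auto simp: digit_powr_def)
    with elim(1) show ?case by (simp add: digit_powr_def)
  qed
qed

lemma pressure_at_boundary:
  assumes "2 * t0 - q0 = 1"
  shows "filterlim (\<lambda>(t, q). pressure t q) at_top (at (t0, q0) within pressure_dom)"
proof -
  let ?F = "at (t0, q0) within pressure_dom"
  have dom: "\<forall>\<^sub>F p in ?F. p \<in> pressure_dom"
    by (simp add: eventually_at_filter)
  have fst: "(fst \<longlongrightarrow> t0) ?F" and snd: "(snd \<longlongrightarrow> q0) ?F"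
    using tendsto_fst[OF tendsto_ident_at[of "(t0, q0)" pressure_dom]]
      tendsto_snd[OF tendsto_ident_at[of "(t0, q0)" pressure_dom]] by simp_all
  have "((\<lambda>p. 2 * fst p - snd p) \<longlongrightarrow> 1) ?F"
    using tendsto_diff[OF tendsto_mult_left[OF fst, of 2] snd] assms by simp
  moreover have "\<forall>\<^sub>F p in ?F. 2 * fst p - snd p \<in> {1<..} \<and> 2 * fst p - snd p \<noteq> 1"
    using dom by eventually_elim (auto simp: pressure_dom_def)
  ultimately have "filterlim (\<lambda>p. 2 * fst p - snd p) (at_right 1) ?F"
    by (simp add: filterlim_at)
  then have "filterlim (\<lambda>p. ln (zeta (2 * fst p - snd p))) at_top ?F"
    by (intro filterlim_compose[OF ln_at_top] filterlim_compose[OF zeta_at_right_1])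
  moreover have "((\<lambda>p. min 0 (- fst p) * ln 4) \<longlongrightarrow> min 0 (- t0) * ln 4) ?F"
    by (intro tendsto_intros fst)
  ultimately have "filterlim (\<lambda>p. min 0 (- fst p) * ln 4 + ln (zeta (2 * fst p - snd p))) at_top ?F"
    by (intro filterlim_tendsto_add_at_top)
  then show ?thesis
  proof (rule filterlim_at_top_mono)
    show "\<forall>\<^sub>F p in ?F. min 0 (- fst p) * ln 4 + ln (zeta (2 * fst p - snd p)) \<le> (case p of (t, q) \<Rightarrow> pressure t q)"
      using dom by eventually_elim (auto simp: pressure_dom_def pressure_bounds(1))
  qed
qed

lemma pressure_at_left:
  "filterlim (pressure t) at_top (at_left (2 * t - 1))"
proof -
  have "filterlim (\<lambda>q. (t, q)) (at (t, 2 * t - 1) within pressure_dom) (at_left (2 * t - 1))"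
    unfolding filterlim_at
    by (auto intro!: tendsto_intros simp: eventually_at_filter pressure_dom_def)
  from filterlim_compose[OF pressure_at_boundary this] show ?thesis by simp
qed

lemma deriv_pressure:
  assumes "2 * t - q > 1"
  shows "0 \<le> deriv (pressure t) q"
    and "2 * t - r > 1 \<Longrightarrow> pressure t q + (r - q) * deriv (pressure t) q \<le> pressure t r"
proof -
  obtain D where D: "0 \<le> D" "(pressure t has_real_derivative D) (at q)"
    "\<And>r. 2 * t - r > 1 \<Longrightarrow> pressure t q + (r - q) * D \<le> pressure t r"
    using pressure_differentiable[OF assms] by metis
  have "deriv (pressure t) q = D" using D(2) by (rule DERIV_imp_deriv)
  then show "0 \<le> deriv (pressure t) q"
    and "2 * t - r > 1 \<Longrightarrow> pressure t q + (r - q) * deriv (pressure t) q \<le> pressure t r"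
    using D by auto
qed

lemma deriv_pressure_at_left:
  "filterlim (deriv (pressure t)) at_top (at_left (2 * t - 1))"
proof (rule filterlim_at_top_mono)
  show "filterlim (\<lambda>q. - pressure t (2 * t - 2) + pressure t q) at_top (at_left (2 * t - 1))"
    by (rule filterlim_tendsto_add_at_top[OF tendsto_const pressure_at_left])
  have "\<forall>\<^sub>F q in at_left (2 * t - 1). q \<in> {2 * t - 2<..<2 * t - 1}"
    by (rule eventually_at_leftI[of "2 * t - 2"]) auto
  then show "\<forall>\<^sub>F q in at_left (2 * t - 1). - pressure t (2 * t - 2) + pressure t q \<le> deriv (pressure t) q"
  proof eventually_elim
    case (elim q)
    then have q: "2 * t - q > 1" by simp
    have "pressure t q - pressure t (2 * t - 2) \<le> (q - (2 * t - 2)) * deriv (pressure t) q"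
      using deriv_pressure(2)[OF q, of "2 * t - 2"] by (simp add: algebra_simps)
    also have "\<dots> \<le> 1 * deriv (pressure t) q"
      using elim deriv_pressure(1)[OF q] by (intro mult_right_mono) auto
    finally show ?case by simp
  qed
qed

lemma pressure_bounded_at_bot:
  obtains C where "0 \<le> C" "\<And>q. q \<le> 2 * t - 2 \<Longrightarrow> \<bar>pressure t q\<bar> \<le> C"
proof
  show "0 \<le> \<bar>t\<bar> * ln 4 + ln (zeta 2)" using zeta_ge_1[of 2] by simp
  fix q assume q: "q \<le> 2 * t - 2"
  then have tq: "2 * t - q > 1" by simp
  have "0 \<le> ln (zeta (2 * t - q))" "ln (zeta (2 * t - q)) \<le> ln (zeta 2)"
    using zeta_ge_1[OF tq] zeta_ge_1[of 2] zeta_antimono[of 2 "2 * t - q"] q by auto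
  moreover have "- (\<bar>t\<bar> * ln 4) \<le> min 0 (- t) * ln 4" "max 0 (- t) * ln 4 \<le> \<bar>t\<bar> * ln 4"
    using mult_right_mono[of "- \<bar>t\<bar>" "min 0 (- t)" "ln 4"] mult_right_mono[of "max 0 (- t)" "\<bar>t\<bar>" "ln 4"]
    by simp_all
  ultimately show "\<bar>pressure t q\<bar> \<le> \<bar>t\<bar> * ln 4 + ln (zeta 2)"
    using pressure_bounds[OF tq] by linarith
qed

lemma pressure_div_at_bot: "((\<lambda>q. pressure t q / q) \<longlongrightarrow> 0) at_bot"
proof -
  obtain C where C: "\<And>q. q \<le> 2 * t - 2 \<Longrightarrow> \<bar>pressure t q\<bar> \<le> C"
    using pressure_bounded_at_bot[of t] by metis
  have "filterlim (\<lambda>q :: real. \<bar>q\<bar>) at_top at_bot"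
    by (rule filterlim_at_top_mono[OF filterlim_uminus_at_top_at_bot]) (intro always_eventually allI abs_ge_minus_self)
  then have "((\<lambda>q. C / \<bar>q\<bar>) \<longlongrightarrow> 0) at_bot"
    by (intro real_tendsto_divide_at_top[OF tendsto_const])
  then show ?thesis
  proof (rule Lim_null_comparison[rotated])
    show "\<forall>\<^sub>F q in at_bot. norm (pressure t q / q) \<le> C / \<bar>q\<bar>"
      using eventually_le_at_bot[of "2 * t - 2"]
      by eventually_elim (auto simp: abs_divide intro!: divide_right_mono C)
  qed
qed

lemma deriv_pressure_at_bot: "(deriv (pressure t) \<longlongrightarrow> 0) at_bot"
proof -
  obtain C where C: "0 \<le> C" "\<And>q. q \<le> 2 * t - 2 \<Longrightarrow> \<bar>pressure t q\<bar> \<le> C"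
    using pressure_bounded_at_bot[of t] by metis
  have "filterlim (\<lambda>q. 2 * t - 2 - q) at_top at_bot"
    using filterlim_tendsto_add_at_top[OF tendsto_const filterlim_uminus_at_top_at_bot, of "2 * t - 2"] by simp
  then have lim: "((\<lambda>q. 2 * C / (2 * t - 2 - q)) \<longlongrightarrow> 0) at_bot"
    by (intro real_tendsto_divide_at_top[OF tendsto_const])
  show ?thesis
  proof (rule tendsto_sandwich[OF _ _ tendsto_const lim])
    show "\<forall>\<^sub>F q in at_bot. 0 \<le> deriv (pressure t) q"
      using eventually_gt_at_bot[of "2 * t - 2"] 
      by eventually_elim (auto intro: deriv_pressure(1))
    show "\<forall>\<^sub>F q in at_bot. deriv (pressure t) q \<le> 2 * C / (2 * t - 2 - q)"
      using eventually_gt_at_bot[of "2 * t - 2"]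
    proof eventually_elim
      case (elim q)
      then have tq: "2 * t - q > 1" by simp
      have "(2 * t - 2 - q) * deriv (pressure t) q \<le> pressure t (2 * t - 2) - pressure t q"
        using deriv_pressure(2)[OF tq, of "2 * t - 2"] by simp
      also have "\<dots> \<le> 2 * C" using C(2)[of q] C(2)[of "2 * t - 2"] elim by simp
      finally show ?case using elim by (simp add: field_simps)
    qed
  qed
qed

theorem proposition4p12:
  shows
        "(\<forall>t q. (t, q) \<in> pressure_dom \<and> t \<ge> 0 \<longrightarrow>
            - t * ln 4 + ln (zeta (2 * t - q)) \<le> pressure t q \<and>
            pressure t q \<le> ln (zeta (2 * t - q))) \<and>
         (\<forall>t q. (t, q) \<in> pressure_dom \<and> t \<le> 0 \<longrightarrow>
            ln (zeta (2 * t - q)) \<le> pressure t q \<and>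
            pressure t q \<le> - t * ln 4 + ln (zeta (2 * t - q))) \<and>
         (\<forall>q. (0, q) \<in> pressure_dom \<longrightarrow> pressure 0 q = ln (zeta (- q))) \<and>
         (\<forall>t0 q0. 2 * t0 - q0 = 1 \<longrightarrow>
            filterlim (\<lambda>(t, q). pressure t q) at_top (at (t0, q0) within pressure_dom)) \<and>
         (\<forall>t. filterlim (\<lambda>q. deriv (\<lambda>r. pressure t r) q) at_top (at_left (2 * t - 1))) \<and>
         (\<forall>t. ((\<lambda>q. pressure t q / q) \<longlongrightarrow> 0) at_bot) \<and>
         (\<forall>t. ((\<lambda>q. deriv (\<lambda>r. pressure t r) q) \<longlongrightarrow> 0) at_bot)"
proof (intro conjI allI impI; (elim conjE)?)
  fix t q :: real assume tq: "(t, q) \<in> pressure_dom" and t: "t \<ge> 0"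
  then have dom: "2 * t - q > 1" by (simp add: pressure_dom_def)
  show "- t * ln 4 + ln (zeta (2 * t - q)) \<le> pressure t q" "pressure t q \<le> ln (zeta (2 * t - q))"
    using pressure_bounds[OF dom] t by simp_all
next
  fix t q :: real assume tq: "(t, q) \<in> pressure_dom" and t: "t \<le> 0"
  then have dom: "2 * t - q > 1" by (simp add: pressure_dom_def)
  show "ln (zeta (2 * t - q)) \<le> pressure t q" "pressure t q \<le> - t * ln 4 + ln (zeta (2 * t - q))"
    using pressure_bounds[OF dom] t by simp_all
next
  fix q :: real assume "(0, q) \<in> pressure_dom"
  then have dom: "2 * 0 - q > 1" by (simp add: pressure_dom_def)
  show "pressure 0 q = ln (zeta (- q))"
    using pressure_bounds[OF dom] by simp
qed (rule pressure_at_boundary deriv_pressure_at_left pressure_div_at_bot deriv_pressure_at_bot, assumption?)+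

end
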